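(* Let $G$ be a finite perfect group with $Z(G) = 1$, and let $n$ be the length of a Krull-Remak-Schmidt decomposition of $G$ as an $\operatorname{Aut}(G)$-group. (1) If $N \in \mathcal{J}(G)$, that is, $N \trianglelefteq \operatorname{Hol}(G)$ is a regular subgroup, then $N \in \mathcal{H}(G)$; in particular $N \cong G$. (2) $\mathcal{H}(G)$ has $2^n$ elements. (3) $T(G)$ is an elementary abelian group of order $2^n$.
   Context: A group $G$ is perfect if $G = G'$. $S(G)$ is the group of all permutations of the set $G$, $\rho : G \to S(G)$ is the right regular representation ($x \mapsto xg$), and $\operatorname{Hol}(G) = N_{S(G)}(\rho(G)) = \operatorname{Aut}(G)\rho(G)$ is the holomorph. The multiple holomorph is $\operatorname{NHol}(G) = N_{S(G)}(\operatorname{Hol}(G))$, and $T(G) = \operatorname{NHol}(G)/\operatorname{Hol}(G)$. Define $$\mathcal{H}(G) = \{ N \le S(G) : N \text{ is regular}, N \cong G \text{ and } N_{S(G)}(N) = \operatorname{Hol}(G) \},$$ $$\mathcal{J}(G) = \{ N \le S(G) : N \text{ is regular}, N \trianglelefteq \operatorname{Hol}(G) \}.$$ A Krull-Remak-Schmidt decomposition of $G$ as an $\operatorname{Aut}(G)$-group is a decomposition $G = A_1 \times \dots \times A_n$ as an internal direct product of non-trivial characteristic subgroups $A_i$ of $G$, none of which can be written as the direct product of two non-trivial subgroups that are characteristic in $G$; its length is $n$. *)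

theory Defs
  imports "HOL-Algebra.Algebra"
begin

definition perfect_group :: "('a, 'b) monoid_scheme \<Rightarrow> bool" where
  "perfect_group G \<longleftrightarrow> group G \<and> derived G (carrier G) = carrier G"

definition center :: "('a, 'b) monoid_scheme \<Rightarrow> 'a set" where
  "center G = {z \<in> carrier G. \<forall>x \<in> carrier G. z \<otimes>\<^bsub>G\<^esub> x = x \<otimes>\<^bsub>G\<^esub> z}"

definition elementary_abelian_group :: "nat \<Rightarrow> ('a, 'b) monoid_scheme \<Rightarrow> bool" where
  "elementary_abelian_group p G \<longleftrightarrow>
     Factorial_Ring.prime p \<and> comm_group G \<and> (\<forall>x \<in> carrier G. x [^]\<^bsub>G\<^esub> p = \<one>\<^bsub>G\<^esub>)"

definition characteristic :: "'a set \<Rightarrow> ('a, 'b) monoid_scheme \<Rightarrow> bool" where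
  "characteristic H G \<longleftrightarrow> subgroup H G \<and> (\<forall>\<phi> \<in> auto G. \<phi> ` H = H)"

definition internal_direct_product ::
    "('a, 'b) monoid_scheme \<Rightarrow> 'i set \<Rightarrow> ('i \<Rightarrow> 'a set) \<Rightarrow> bool" where
  "internal_direct_product G I A \<longleftrightarrow>
     (\<forall>i \<in> I. A i \<lhd> G) \<and>
     generate G (\<Union>i \<in> I. A i) = carrier G \<and>
     (\<forall>i \<in> I. A i \<inter> generate G (\<Union>j \<in> I - {i}. A j) = {\<one>\<^bsub>G\<^esub>})"

text \<open>The factors are \<open>A 1, \<dots>, A n\<close>. The trivial group has the empty decomposition,
  of length 0.\<close>

definition KRS_decomposition ::
    "('a, 'b) monoid_scheme \<Rightarrow> nat \<Rightarrow> (nat \<Rightarrow> 'a set) \<Rightarrow> bool" where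
  "KRS_decomposition G n A \<longleftrightarrow>
     internal_direct_product G {1..n} A \<and>
     (\<forall>i \<in> {1..n}. characteristic (A i) G \<and> A i \<noteq> {\<one>\<^bsub>G\<^esub>} \<and>
        \<not> (\<exists>B C. characteristic B G \<and> characteristic C G \<and>
              B \<noteq> {\<one>\<^bsub>G\<^esub>} \<and> C \<noteq> {\<one>\<^bsub>G\<^esub>} \<and>
              internal_direct_product (G\<lparr>carrier := A i\<rparr>) UNIV (case_bool B C)))"

text \<open>The multiplication of \<^const>\<open>BijGroup\<close> is composition of functions written on the
  left. For permutations written on the right one gets the opposite group, which has the
  same subgroups, the same normalizers and the same regular and normal subgroups, and the
  inversion map identifies each subgroup with its opposite. With functions written on the left,
  \<open>g \<mapsto> (x \<mapsto> x g)\<close> is an antihomomorphism; only its image is used below.\<close>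

abbreviation Sym :: "('a, 'b) monoid_scheme \<Rightarrow> ('a \<Rightarrow> 'a) monoid" where
  "Sym G \<equiv> BijGroup (carrier G)"

definition right_regular :: "('a, 'b) monoid_scheme \<Rightarrow> 'a \<Rightarrow> 'a \<Rightarrow> 'a" where
  "right_regular G g = (\<lambda>x \<in> carrier G. x \<otimes>\<^bsub>G\<^esub> g)"

definition Hol :: "('a, 'b) monoid_scheme \<Rightarrow> ('a \<Rightarrow> 'a) set" where
  "Hol G = normalizer (Sym G) (right_regular G ` carrier G)"

definition NHol :: "('a, 'b) monoid_scheme \<Rightarrow> ('a \<Rightarrow> 'a) set" where
  "NHol G = normalizer (Sym G) (Hol G)"

definition T :: "('a, 'b) monoid_scheme \<Rightarrow> ('a \<Rightarrow> 'a) set monoid" where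
  "T G = (Sym G)\<lparr>carrier := NHol G\<rparr> Mod Hol G"

definition regular_subgroup :: "('a \<Rightarrow> 'a) set \<Rightarrow> 'a set \<Rightarrow> bool" where
  "regular_subgroup N E \<longleftrightarrow>
     subgroup N (BijGroup E) \<and>
     transitive_action ((BijGroup E)\<lparr>carrier := N\<rparr>) E (\<lambda>f. f) \<and>
     (\<forall>x \<in> E. stabilizer ((BijGroup E)\<lparr>carrier := N\<rparr>) (\<lambda>f. f) x = {\<one>\<^bsub>BijGroup E\<^esub>})"

definition HH :: "('a, 'b) monoid_scheme \<Rightarrow> ('a \<Rightarrow> 'a) set set" where
  "HH G = {N. regular_subgroup N (carrier G) \<and> (Sym G)\<lparr>carrier := N\<rparr> \<cong> G \<and>
              normalizer (Sym G) N = Hol G}"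

definition JJ :: "('a, 'b) monoid_scheme \<Rightarrow> ('a \<Rightarrow> 'a) set set" where
  "JJ G = {N. regular_subgroup N (carrier G) \<and> N \<lhd> (Sym G)\<lparr>carrier := Hol G\<rparr>}"

end

theory Submission
  imports Defs
begin

text \<open>Let \<open>R\<close> and \<open>L\<close> be the groups of right and left translations, and let \<open>N\<close> be a regular
  normal subgroup of \<open>Hol G\<close>. Put \<open>N \<inter> R = \<rho>(U)\<close> and \<open>N \<inter> L = \<lambda>(V)\<close>. If \<open>\<nu> \<in> N\<close> is
  \<open>x \<mapsto> \<phi>(x) g\<close> with \<open>\<phi>\<close> an automorphism, the commutators of \<open>\<nu>\<close> with \<open>L\<close> and \<open>R\<close>, which lie
  in \<open>N \<inter> L\<close> and \<open>N \<inter> R\<close>, give \<open>\<phi>(x) x\<^sup>-\<^sup>1 \<in> V\<close> and \<open>x\<^sup>-\<^sup>1 g\<^sup>-\<^sup>1 \<phi>(x) g \<in> U\<close>. Since \<open>g\<close> is arbitrary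
  by transitivity, \<open>V U\<close> contains all commutators, hence equals \<open>G\<close>. Elements of \<open>U \<inter> V\<close> are
  central by regularity, so \<open>G = U \<times> V\<close> with characteristic factors and \<open>N\<close> consists of the maps
  \<open>x \<mapsto> v x u\<close>. This \<open>N\<close> is the conjugate of \<open>R\<close> under the involution \<open>u v \<mapsto> u v\<^sup>-\<^sup>1\<close>, which lies
  in \<open>NHol G\<close>. So \<open>NHol G\<close> acts transitively on \<open>JJ G = HH G\<close> with the stabilizer \<open>Hol G\<close> of \<open>R\<close>,
  and every coset of \<open>Hol G\<close> contains an involution or \<open>1\<close>. Finally, each indecomposable
  characteristic factor \<open>A i\<close> splits along \<open>G = U \<times> V\<close> because \<open>G\<close> is perfect, so it lies in \<open>U\<close> or
  in \<open>V\<close>, and the pairs \<open>(U, V)\<close> correspond to the subsets of \<open>{1..n}\<close>.\<close>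

section \<open>Conjugation and normalizers\<close>

context group
begin

lemma inv_mult_cancel [simp]:
  assumes "x \<in> carrier G" "y \<in> carrier G"
  shows "inv x \<otimes> (x \<otimes> y) = y" "x \<otimes> (inv x \<otimes> y) = y"
  using assms by (simp_all flip: m_assoc)

lemma normalizer_eq:
  assumes "K \<subseteq> carrier G"
  shows "normalizer G K = {g \<in> carrier G. (\<lambda>k. g \<otimes> k \<otimes> inv g) ` K = K}"
proof -
  have "(g <# K) #> inv g = (\<lambda>k. g \<otimes> k \<otimes> inv g) ` K" for g
    by (auto simp: l_coset_def r_coset_def)
  then show ?thesis
    using assms by (simp add: normalizer_def stabilizer_def)
qed

lemma conjugate_image_comp:
  assumes "K \<subseteq> carrier G" "g \<in> carrier G" "h \<in> carrier G"
  shows "(\<lambda>k. g \<otimes> k \<otimes> inv g) ` (\<lambda>k. h \<otimes> k \<otimes> inv h) ` K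
    = (\<lambda>k. (g \<otimes> h) \<otimes> k \<otimes> inv (g \<otimes> h)) ` K"
  unfolding image_image using assms
  by (intro image_cong) (auto simp: inv_mult_group m_assoc subset_iff)

lemma conjugate_image_one:
  assumes "K \<subseteq> carrier G"
  shows "(\<lambda>k. \<one> \<otimes> k \<otimes> inv \<one>) ` K = K"
proof -
  have "(\<lambda>k. \<one> \<otimes> k \<otimes> inv \<one>) ` K = (\<lambda>k. k) ` K"
    using assms by (intro image_cong) (auto simp: subset_iff)
  then show ?thesis by simp
qed

text \<open>Orbit-stabilizer for conjugation: conjugating both sides by \<open>inv h\<close> turns
  the equation into the statement that \<open>inv h \<otimes> g\<close> fixes \<open>K\<close>. With
  the right translations as \<open>K\<close> it matches conjugates with cosets of
  \<open>Hol G\<close>.\<close>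

lemma conjugate_image_eq_iff:
  assumes K: "K \<subseteq> carrier G" and gh: "g \<in> carrier G" "h \<in> carrier G"
  shows "(\<lambda>k. g \<otimes> k \<otimes> inv g) ` K = (\<lambda>k. h \<otimes> k \<otimes> inv h) ` K
    \<longleftrightarrow> inv h \<otimes> g \<in> normalizer G K" (is "?l = ?r \<longleftrightarrow> _")
proof -
  define P where "P = (\<lambda>k. (inv h \<otimes> g) \<otimes> k \<otimes> inv (inv h \<otimes> g)) ` K"
  have "P = (\<lambda>k. inv h \<otimes> k \<otimes> inv (inv h)) ` ?l"
    using conjugate_image_comp[OF K, of "inv h" g] gh by (simp add: P_def)
  moreover have "(\<lambda>k. inv h \<otimes> k \<otimes> inv (inv h)) ` ?r = K"
    using conjugate_image_comp[OF K, of "inv h" h] gh conjugate_image_one[OF K] by simp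
  moreover have "(\<lambda>k. h \<otimes> k \<otimes> inv h) ` P = ?l"
    using conjugate_image_comp[OF K, of h "inv h \<otimes> g"] gh by (simp add: P_def)
  ultimately have "?l = ?r \<longleftrightarrow> P = K"
    by metis
  then show ?thesis
    using gh by (simp add: normalizer_eq[OF K] P_def)
qed

text \<open>An element \<open>h\<close> normalizes the conjugate of \<open>K\<close> by
  \<open>g\<close> iff \<open>h \<otimes> g\<close> and \<open>g\<close> conjugate \<open>K\<close>
  to the same set, that is, iff \<open>inv g \<otimes> h \<otimes> g\<close> normalizes
  \<open>K\<close>.\<close>

lemma normalizer_conjugate_image:
  assumes K: "K \<subseteq> carrier G" and g: "g \<in> carrier G"
  shows "normalizer G ((\<lambda>k. g \<otimes> k \<otimes> inv g) ` K) = (\<lambda>k. g \<otimes> k \<otimes> inv g) ` normalizer G K"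
proof -
  have sub: "(\<lambda>k. g \<otimes> k \<otimes> inv g) ` K \<subseteq> carrier G"
    using K g by auto
  have iff: "h \<in> normalizer G ((\<lambda>k. g \<otimes> k \<otimes> inv g) ` K) \<longleftrightarrow> inv g \<otimes> h \<otimes> g \<in> normalizer G K"
    if h: "h \<in> carrier G" for h
    using conjugate_image_eq_iff[OF K, of "h \<otimes> g" g] conjugate_image_comp[OF K h g] h g
    by (simp add: normalizer_eq[OF sub] m_assoc)
  have nK: "normalizer G K \<subseteq> carrier G"
    by (auto simp: normalizer_eq[OF K])
  show ?thesis
  proof (intro equalityI subsetI)
    fix h assume h: "h \<in> normalizer G ((\<lambda>k. g \<otimes> k \<otimes> inv g) ` K)"
    then have hc: "h \<in> carrier G" by (simp add: normalizer_eq[OF sub])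
    then have "h = g \<otimes> (inv g \<otimes> h \<otimes> g) \<otimes> inv g"
      using g by (simp add: m_assoc)
    then show "h \<in> (\<lambda>k. g \<otimes> k \<otimes> inv g) ` normalizer G K"
      using h iff[OF hc] by blast
  next
    fix h assume "h \<in> (\<lambda>k. g \<otimes> k \<otimes> inv g) ` normalizer G K"
    then obtain k where k: "k \<in> normalizer G K" "h = g \<otimes> k \<otimes> inv g" by auto
    then have "inv g \<otimes> h \<otimes> g = k"
      using g nK by (auto simp: m_assoc subset_iff)
    then show "h \<in> normalizer G ((\<lambda>k. g \<otimes> k \<otimes> inv g) ` K)"
      using k iff[of h] g nK by (auto simp: subset_iff)
  qed
qed

lemma subgroup_conjugate_image:
  assumes "subgroup K G" "g \<in> carrier G"
  shows "subgroup ((\<lambda>k. g \<otimes> k \<otimes> inv g) ` K) G"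
proof -
  interpret K: subgroup K G by fact
  \<comment> \<open>Membership is pulled back to \<open>K\<close> by conjugating with
    \<open>inv g\<close>, so that each closure property becomes the one of \<open>K\<close>.\<close>
  have mem: "x \<in> (\<lambda>k. g \<otimes> k \<otimes> inv g) ` K \<longleftrightarrow> x \<in> carrier G \<and> inv g \<otimes> x \<otimes> g \<in> K" for x
  proof
    assume "x \<in> (\<lambda>k. g \<otimes> k \<otimes> inv g) ` K"
    then show "x \<in> carrier G \<and> inv g \<otimes> x \<otimes> g \<in> K"
      using assms(2) by (auto simp: m_assoc)
  next
    assume "x \<in> carrier G \<and> inv g \<otimes> x \<otimes> g \<in> K"
    then show "x \<in> (\<lambda>k. g \<otimes> k \<otimes> inv g) ` K"
      using assms(2) by (intro image_eqI[of _ _ "inv g \<otimes> x \<otimes> g"]) (auto simp: m_assoc)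
  qed
  show ?thesis
  proof (rule subgroup.intro)
    fix x y assume "x \<in> (\<lambda>k. g \<otimes> k \<otimes> inv g) ` K" "y \<in> (\<lambda>k. g \<otimes> k \<otimes> inv g) ` K"
    moreover from this have "inv g \<otimes> (x \<otimes> y) \<otimes> g = (inv g \<otimes> x \<otimes> g) \<otimes> (inv g \<otimes> y \<otimes> g)"
      using assms(2) unfolding mem by (simp add: m_assoc)
    ultimately show "x \<otimes> y \<in> (\<lambda>k. g \<otimes> k \<otimes> inv g) ` K"
      unfolding mem by simp
  next
    fix x assume "x \<in> (\<lambda>k. g \<otimes> k \<otimes> inv g) ` K"
    moreover from this have "inv g \<otimes> inv x \<otimes> g = inv (inv g \<otimes> x \<otimes> g)"
      using assms(2) unfolding mem by (simp add: inv_mult_group m_assoc)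
    ultimately show "inv x \<in> (\<lambda>k. g \<otimes> k \<otimes> inv g) ` K"
      unfolding mem by simp
  qed (use assms(2) mem in auto)
qed

lemma conjugate_image_iso:
  assumes "subgroup K G" "g \<in> carrier G"
  shows "G\<lparr>carrier := K\<rparr> \<cong> G\<lparr>carrier := (\<lambda>k. g \<otimes> k \<otimes> inv g) ` K\<rparr>"
proof -
  interpret K: subgroup K G by fact
  have "(\<lambda>k. g \<otimes> k \<otimes> inv g) \<in> iso (G\<lparr>carrier := K\<rparr>) (G\<lparr>carrier := (\<lambda>k. g \<otimes> k \<otimes> inv g) ` K\<rparr>)"
    using assms by (auto simp: iso_def hom_def bij_betw_def inj_on_def m_assoc)
  then show ?thesis by (auto simp: is_iso_def)
qed

text \<open>Normality in a restricted carrier refers to the inverse of the restricted record; here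
  it is expressed by the operations of \<open>G\<close>, so that facts about \<open>JJ\<close>,
  \<open>Hol\<close> and \<open>NHol\<close> can all be used inside the one group
  \<open>Sym G\<close>.\<close>

lemma normal_restrict_iff:
  assumes H: "subgroup H G"
  shows "N \<lhd> G\<lparr>carrier := H\<rparr>
    \<longleftrightarrow> subgroup N G \<and> N \<subseteq> H \<and> (\<forall>h \<in> H. \<forall>k \<in> N. h \<otimes> k \<otimes> inv h \<in> N)"
proof -
  interpret H: group "G\<lparr>carrier := H\<rparr>" using H by (rule subgroup_imp_group)
  have "subgroup N (G\<lparr>carrier := H\<rparr>) \<longleftrightarrow> subgroup N G \<and> N \<subseteq> H"
  proof
    assume N: "subgroup N (G\<lparr>carrier := H\<rparr>)"
    then show "subgroup N G \<and> N \<subseteq> H"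
      using incl_subgroup[OF H] subgroup.subset[OF N] by simp
  qed (use H subgroup_incl in blast)
  moreover have "inv\<^bsub>G\<lparr>carrier := H\<rparr>\<^esub> h = inv h" if "h \<in> H" for h
    using m_inv_consistent[OF H that] .
  ultimately show ?thesis
    by (simp add: H.normal_inv_iff)
qed

end

section \<open>Characteristic direct decompositions\<close>

text \<open>Factors may be trivial, so the pairs \<open>(G, 1)\<close> and \<open>(1, G)\<close>
  count; they give the right and the left translations. Elementwise commutation is left to
  \<open>normal_disjoint_commute\<close>.\<close>

definition characteristic_decomposition :: "('a, 'b) monoid_scheme \<Rightarrow> 'a set \<Rightarrow> 'a set \<Rightarrow> bool" where
  "characteristic_decomposition G U V \<longleftrightarrow>
     characteristic U G \<and> characteristic V G \<and> U \<inter> V = {\<one>\<^bsub>G\<^esub>} \<and> set_mult G U V = carrier G"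

lemma set_mult_carrierE:
  assumes "set_mult G U V = carrier G" "g \<in> carrier G"
  obtains x y where "x \<in> U" "y \<in> V" "g = x \<otimes>\<^bsub>G\<^esub> y"
proof -
  have "g \<in> set_mult G U V" using assms by simp
  then show ?thesis using that by (auto simp: set_mult_def)
qed

section \<open>Commutators, automorphisms and characteristic subgroups\<close>

context group
begin

text \<open>The derived subgroup is generated by the commutators, and perfectness makes it
  everything.\<close>

lemma perfect_group_eqI:
  assumes "perfect_group G" "subgroup D G"
    and "\<And>x y. x \<in> carrier G \<Longrightarrow> y \<in> carrier G \<Longrightarrow> x \<otimes> y \<otimes> inv x \<otimes> inv y \<in> D"
  shows "D = carrier G"
proof -
  have "derived G (carrier G) \<subseteq> D"
    unfolding derived_def using assms by (intro generate_subgroup_incl) auto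
  then show ?thesis
    using assms subgroup.subset[of D G] by (auto simp: perfect_group_def)
qed

lemma normal_commutator:
  assumes "N \<lhd> G" "a \<in> N" "g \<in> carrier G"
  shows "a \<otimes> g \<otimes> inv a \<otimes> inv g \<in> N"
proof -
  interpret N: normal N G by fact
  have "a \<otimes> (g \<otimes> inv a \<otimes> inv g) \<in> N"
    using assms by (intro N.m_closed N.inv_op_closed2) auto
  then show ?thesis using assms by (simp add: m_assoc)
qed

text \<open>The commutator of \<open>a\<close> and \<open>b\<close> lies in both normal
  subgroups.\<close>

lemma normal_disjoint_commute:
  assumes "M \<lhd> G" "N \<lhd> G" "M \<inter> N = {\<one>}" "a \<in> M" "b \<in> N"
  shows "a \<otimes> b = b \<otimes> a"
proof -
  interpret M: normal M G by fact
  interpret N: normal N G by fact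
  have [simp]: "a \<in> carrier G" "b \<in> carrier G" using assms by auto
  have "(a \<otimes> b \<otimes> inv a) \<otimes> inv b \<in> N"
    by (intro N.m_closed N.inv_op_closed2 N.m_inv_closed assms(5)) simp
  then have "a \<otimes> b \<otimes> inv a \<otimes> inv b \<in> M \<inter> N"
    using normal_commutator[of M a b] assms by auto
  then have "a \<otimes> b \<otimes> inv a \<otimes> inv b \<otimes> (b \<otimes> a) = b \<otimes> a"
    using assms(3) by auto
  then show ?thesis by (simp add: m_assoc)
qed

text \<open>Elements of \<open>auto G\<close> are extensional, hence the restriction to
  \<open>carrier G\<close>.\<close>

lemma conjugation_auto:
  assumes g: "g \<in> carrier G"
  shows "(\<lambda>x \<in> carrier G. g \<otimes> x \<otimes> inv g) \<in> auto G"
proof -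
  have "bij_betw (\<lambda>x \<in> carrier G. g \<otimes> x \<otimes> inv g) (carrier G) (carrier G)"
    by (rule bij_betw_byWitness[where f' = "\<lambda>x. inv g \<otimes> x \<otimes> g"]) (use g in \<open>auto simp: m_assoc\<close>)
  moreover have "(\<lambda>x \<in> carrier G. g \<otimes> x \<otimes> inv g) \<in> hom G G"
    using g by (intro homI) (auto simp: m_assoc)
  ultimately show ?thesis
    by (simp add: auto_def Bij_def)
qed

lemma characteristic_imp_normal:
  assumes "characteristic H G"
  shows "H \<lhd> G"
  unfolding normal_inv_iff
proof (intro conjI ballI)
  show H: "subgroup H G" using assms by (simp add: characteristic_def)
  fix g h assume g: "g \<in> carrier G" and h: "h \<in> H"
  then have "(\<lambda>x \<in> carrier G. g \<otimes> x \<otimes> inv g) h \<in> H"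
    using assms conjugation_auto unfolding characteristic_def by blast
  then show "g \<otimes> h \<otimes> inv g \<in> H"
    using subgroup.mem_carrier[OF H h] by simp
qed

lemma auto_closed: "\<phi> \<in> auto G \<Longrightarrow> x \<in> carrier G \<Longrightarrow> \<phi> x \<in> carrier G"
  by (auto simp: auto_def hom_def)

lemma auto_mult:
  "\<phi> \<in> auto G \<Longrightarrow> x \<in> carrier G \<Longrightarrow> y \<in> carrier G \<Longrightarrow> \<phi> (x \<otimes> y) = \<phi> x \<otimes> \<phi> y"
  by (auto simp: auto_def hom_def)

lemma auto_group_hom: "\<phi> \<in> auto G \<Longrightarrow> group_hom G G \<phi>"
  by (simp add: auto_def group_hom_def group_hom_axioms_def)

lemma auto_inj: "\<phi> \<in> auto G \<Longrightarrow> inj_on \<phi> (carrier G)"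
  by (simp add: auto_def Bij_def bij_betw_def)

lemma characteristic_Int:
  assumes "characteristic H G" "characteristic K G"
  shows "characteristic (H \<inter> K) G"
proof -
  have "\<phi> ` (H \<inter> K) = H \<inter> K" if "\<phi> \<in> auto G" for \<phi>
    using inj_on_image_Int[OF auto_inj[OF that], of H K] assms that
    by (simp add: characteristic_def subgroup.subset)
  then show ?thesis
    using assms subgroups_Inter_pair by (auto simp: characteristic_def)
qed

lemma characteristic_generate_UN:
  assumes "\<And>i. i \<in> S \<Longrightarrow> characteristic (A i) G"
  shows "characteristic (generate G (\<Union>i \<in> S. A i)) G"
proof -
  have sub: "(\<Union>i \<in> S. A i) \<subseteq> carrier G"
    using assms by (auto simp: characteristic_def dest: subgroup.subset)
  have "\<phi> ` generate G (\<Union>i \<in> S. A i) = generate G (\<Union>i \<in> S. A i)" if "\<phi> \<in> auto G" for \<phi>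
    using group_hom.generate_img[OF auto_group_hom[OF that] sub] assms that
    by (simp add: image_UN characteristic_def)
  then show ?thesis
    using generate_is_subgroup[OF sub] by (simp add: characteristic_def)
qed

text \<open>Centralizers are subgroups, which is used twice: first \<open>generate G H\<close>
  centralizes \<open>K\<close>, then \<open>generate G K\<close> centralizes
  \<open>generate G H\<close>.\<close>

lemma generate_commute:
  assumes "H \<subseteq> carrier G" "K \<subseteq> carrier G"
    and "\<And>h k. h \<in> H \<Longrightarrow> k \<in> K \<Longrightarrow> h \<otimes> k = k \<otimes> h"
    and "x \<in> generate G H" "y \<in> generate G K"
  shows "x \<otimes> y = y \<otimes> x"
proof -
  have centralizer: "subgroup {c \<in> carrier G. \<forall>k \<in> L. c \<otimes> k = k \<otimes> c} G" if "L \<subseteq> carrier G" for L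
  proof (rule subgroup.intro)
    fix x y
    assume *: "x \<in> {c \<in> carrier G. \<forall>k \<in> L. c \<otimes> k = k \<otimes> c}"
      "y \<in> {c \<in> carrier G. \<forall>k \<in> L. c \<otimes> k = k \<otimes> c}"
    have "x \<otimes> y \<otimes> k = k \<otimes> (x \<otimes> y)" if "k \<in> L" for k
    proof -
      have k: "k \<in> carrier G" using that \<open>L \<subseteq> carrier G\<close> by auto
      have xk: "x \<otimes> k = k \<otimes> x" and yk: "y \<otimes> k = k \<otimes> y"
        and xy: "x \<in> carrier G" "y \<in> carrier G" using * that by auto
      have "x \<otimes> y \<otimes> k = x \<otimes> k \<otimes> y" using xy k by (simp add: m_assoc yk)
      then show ?thesis using xy k by (simp add: m_assoc xk)
    qed
    then show "x \<otimes> y \<in> {c \<in> carrier G. \<forall>k \<in> L. c \<otimes> k = k \<otimes> c}" using * by auto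
  next
    fix x assume *: "x \<in> {c \<in> carrier G. \<forall>k \<in> L. c \<otimes> k = k \<otimes> c}"
    have "inv x \<otimes> k = k \<otimes> inv x" if "k \<in> L" for k
    proof -
      have k: "k \<in> carrier G" using that \<open>L \<subseteq> carrier G\<close> by auto
      have "inv x \<otimes> (x \<otimes> k) \<otimes> inv x = inv x \<otimes> (k \<otimes> x) \<otimes> inv x" using * that by simp
      then show ?thesis using * k by (simp add: m_assoc)
    qed
    then show "inv x \<in> {c \<in> carrier G. \<forall>k \<in> L. c \<otimes> k = k \<otimes> c}" using * by auto
  qed (use that in \<open>auto simp: subset_iff\<close>)
  have "generate G H \<subseteq> {c \<in> carrier G. \<forall>k \<in> K. c \<otimes> k = k \<otimes> c}"
    using assms by (intro generate_subgroup_incl centralizer) auto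
  moreover have "generate G K \<subseteq> {c \<in> carrier G. \<forall>k \<in> generate G H. c \<otimes> k = k \<otimes> c}"
    using calculation assms(2) by (intro generate_subgroup_incl centralizer generate_incl assms(1)) auto
  ultimately show ?thesis
    using assms(4,5) by auto
qed

text \<open>An element of \<open>U \<inter> V\<close> commutes with \<open>U\<close> as a member of
  \<open>V\<close> and with \<open>V\<close> as a member of \<open>U\<close>, so it is central and
  therefore trivial.\<close>

lemma characteristic_decomposition_centerless:
  assumes "center G = {\<one>}" "characteristic U G" "characteristic V G" "U <#> V = carrier G"
    and "\<And>x y. x \<in> U \<Longrightarrow> y \<in> V \<Longrightarrow> x \<otimes> y = y \<otimes> x"
  shows "characteristic_decomposition G U V"
proof -
  interpret U: subgroup U G using assms by (simp add: characteristic_def)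
  interpret V: subgroup V G using assms by (simp add: characteristic_def)
  have "z = \<one>" if z: "z \<in> U" "z \<in> V" for z
  proof -
    have "z \<otimes> g = g \<otimes> z" if "g \<in> carrier G" for g
    proof -
      obtain x y where g: "x \<in> U" "y \<in> V" "g = x \<otimes> y"
        using set_mult_carrierE[OF assms(4) \<open>g \<in> carrier G\<close>] by metis
      have [simp]: "x \<in> carrier G" "y \<in> carrier G" "z \<in> carrier G" using g z by auto
      have "z \<otimes> g = (x \<otimes> z) \<otimes> y"
        using assms(5)[of x z] g z by (simp add: m_assoc)
      also have "\<dots> = g \<otimes> z"
        using assms(5)[of z y] g z by (simp add: m_assoc)
      finally show ?thesis .
    qed
    then have "z \<in> center G" using z by (simp add: center_def)
    then show ?thesis using assms(1) by simp
  qed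
  then show ?thesis
    using assms unfolding characteristic_decomposition_def by auto
qed

text \<open>Modulo \<open>C\<close> the factor \<open>B\<close> is the perfect group
  \<open>G\<close>/\<open>C\<close>, so commutators account for all of it; and a commutator of
  \<open>b\<close> in \<open>B\<close> with a product \<open>x \<otimes> y\<close> from
  \<open>U\<close> and \<open>V\<close> breaks up into a part in \<open>B \<inter> U\<close> and a
  part in \<open>B \<inter> V\<close>.\<close>

lemma perfect_direct_factor_splits:
  assumes perfect: "perfect_group G"
    and B: "B \<lhd> G" and C: "C \<lhd> G" and BC: "B \<inter> C = {\<one>}" "B <#> C = carrier G"
    and U: "U \<lhd> G" and V: "V \<lhd> G" and UV: "U <#> V = carrier G"
  shows "(B \<inter> U) <#> (B \<inter> V) = B"
proof -
  interpret B: normal B G by fact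
  interpret C: normal C G by fact
  interpret U: normal U G by fact
  interpret V: normal V G by fact
  define D where "D = (B \<inter> U) <#> (B \<inter> V)"
  have BU: "B \<inter> U \<lhd> G" and BV: "B \<inter> V \<lhd> G"
    using normal_subgroup_intersect B U V by auto
  have D: "subgroup D G"
    unfolding D_def using BU BV by (intro mult_norm_subgroup normal_imp_subgroup)
  have DB: "D \<subseteq> B" by (auto simp: D_def set_mult_def)
  have comm_D: "b \<otimes> g \<otimes> inv b \<otimes> inv g \<in> D" if b: "b \<in> B" and g: "g \<in> carrier G" for b g
  proof -
    obtain x y where xy: "x \<in> U" "y \<in> V" "g = x \<otimes> y"
      using set_mult_carrierE[OF UV g] by metis
    have [simp]: "x \<in> carrier G" "y \<in> carrier G" "b \<in> carrier G" using xy b by auto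
    have "(b \<otimes> x \<otimes> inv b) \<otimes> inv x \<in> U"
      using xy by (intro U.m_closed U.inv_op_closed2) auto
    then have 1: "b \<otimes> x \<otimes> inv b \<otimes> inv x \<in> B \<inter> U"
      using normal_commutator[OF B b, of x] by auto
    have "(b \<otimes> y \<otimes> inv b) \<otimes> inv y \<in> V"
      using xy by (intro V.m_closed V.inv_op_closed2) auto
    then have 2: "x \<otimes> (b \<otimes> y \<otimes> inv b \<otimes> inv y) \<otimes> inv x \<in> B \<inter> V"
      using normal_commutator[OF B b, of y] by (intro normal.inv_op_closed2[OF BV]) auto
    \<comment> \<open>The identity \<open>[b, x y] = [b, x] * x [b, y] x^-1\<close>; the conjugation
      by \<open>x\<close> stays in \<open>B \<inter> V\<close> because that subgroup is
      normal.\<close>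
    have "b \<otimes> g \<otimes> inv b \<otimes> inv g
      = (b \<otimes> x \<otimes> inv b \<otimes> inv x) \<otimes> (x \<otimes> (b \<otimes> y \<otimes> inv b \<otimes> inv y) \<otimes> inv x)"
      by (simp add: xy m_assoc inv_mult_group)
    then show ?thesis
      using 1 2 unfolding D_def set_mult_def by blast
  qed
  have "C <#> D = carrier G"
  proof (rule perfect_group_eqI[OF perfect])
    show "subgroup (C <#> D) G" using C D by (rule mult_norm_subgroup)
    fix h g assume h: "h \<in> carrier G" and g: "g \<in> carrier G"
    obtain b c where bc: "b \<in> B" "c \<in> C" "h = b \<otimes> c"
      using set_mult_carrierE[OF BC(2) h] by metis
    have [simp]: "b \<in> carrier G" "c \<in> carrier G" using bc by auto
    \<comment> \<open>The identity \<open>[b c, g] = b [c, g] b^-1 * [b, g]\<close>: up to an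
      element of \<open>C\<close>, only the component in \<open>B\<close> matters.\<close>
    have "h \<otimes> g \<otimes> inv h \<otimes> inv g
      = (b \<otimes> (c \<otimes> g \<otimes> inv c \<otimes> inv g) \<otimes> inv b) \<otimes> (b \<otimes> g \<otimes> inv b \<otimes> inv g)"
      using g by (simp add: bc m_assoc inv_mult_group)
    moreover have "b \<otimes> (c \<otimes> g \<otimes> inv c \<otimes> inv g) \<otimes> inv b \<in> C"
      using normal_commutator[OF C bc(2) g] by (intro C.inv_op_closed2) auto
    ultimately show "h \<otimes> g \<otimes> inv h \<otimes> inv g \<in> C <#> D"
      using comm_D[OF bc(1) g] unfolding set_mult_def by blast
  qed
  \<comment> \<open>Dedekind's modular law: since \<open>D\<close> lies in \<open>B\<close>, the
    \<open>C\<close>-component of an element of \<open>B\<close> lies in \<open>B \<inter> C\<close>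
    and vanishes.\<close>
  have "b \<in> D" if b: "b \<in> B" for b
  proof -
    have "b \<in> C <#> D" using \<open>C <#> D = carrier G\<close> b by auto
    then obtain c d where cd: "c \<in> C" "d \<in> D" "b = c \<otimes> d"
      by (auto simp: set_mult_def)
    moreover have d: "d \<in> B" using cd DB by auto
    ultimately have "c = b \<otimes> inv d"
      by (simp add: m_assoc)
    then have "c \<in> B \<inter> C" using B.m_closed[OF b B.m_inv_closed[OF d]] cd by simp
    then have "c = \<one>" using BC by auto
    then show ?thesis using cd d by simp
  qed
  then show ?thesis using DB unfolding D_def by auto
qed

section \<open>Grouping the factors of a direct decomposition\<close>

lemma internal_direct_product_complement:
  assumes idp: "internal_direct_product G I A" and S: "S \<subseteq> I"
    and char: "\<And>i. i \<in> I \<Longrightarrow> characteristic (A i) G"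
  shows "generate G (\<Union>i \<in> S. A i) <#> generate G (\<Union>i \<in> I - S. A i) = carrier G"
    (is "?U <#> ?V = _")
proof -
  have U: "characteristic ?U G" and V: "characteristic ?V G"
    using char S by (auto intro!: characteristic_generate_UN)
  interpret U: subgroup ?U G using U by (simp add: characteristic_def)
  interpret V: subgroup ?V G using V by (simp add: characteristic_def)
  \<comment> \<open>The product is a subgroup because one part is normal, so it is enough that it
    contains each single factor.\<close>
  have sub: "subgroup (?U <#> ?V) G"
    using characteristic_imp_normal[OF U] V.subgroup_axioms by (rule mult_norm_subgroup)
  have "a \<in> ?U <#> ?V" if "i \<in> I" "a \<in> A i" for i a
  proof -
    have a: "a \<in> carrier G"
      using char[OF that(1)] that(2) by (auto simp: characteristic_def dest: subgroup.mem_carrier)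
    show ?thesis
    proof (cases "i \<in> S")
      case True
      then have "a \<in> ?U" using that by (auto intro: generate.incl)
      then have "a \<otimes> \<one> \<in> ?U <#> ?V" unfolding set_mult_def using V.one_closed by blast
      then show ?thesis using a by simp
    next
      case False
      then have "a \<in> ?V" using that by (auto intro: generate.incl)
      then have "\<one> \<otimes> a \<in> ?U <#> ?V" unfolding set_mult_def using U.one_closed by blast
      then show ?thesis using a by simp
    qed
  qed
  then have "generate G (\<Union>i \<in> I. A i) \<subseteq> ?U <#> ?V"
    by (intro generate_subgroup_incl sub) auto
  then show ?thesis
    using idp subgroup.subset[OF sub] by (auto simp: internal_direct_product_def)
qed

text \<open>Distinct factors commute because they are normal and disjoint, and this passes to the
  generated subgroups. The trivial intersection of the two parts is then obtained from the trivial
  center.\<close>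

lemma internal_direct_product_parts:
  assumes idp: "internal_direct_product G I A" and S: "S \<subseteq> I"
    and char: "\<And>i. i \<in> I \<Longrightarrow> characteristic (A i) G"
    and center: "center G = {\<one>}"
  shows "characteristic_decomposition G (generate G (\<Union>i \<in> S. A i)) (generate G (\<Union>i \<in> I - S. A i))"
proof (rule characteristic_decomposition_centerless[OF center])
  have carr: "A i \<subseteq> carrier G" if "i \<in> I" for i
    using char[OF that] by (auto simp: characteristic_def dest: subgroup.subset)
  have comm: "a \<otimes> b = b \<otimes> a" if "i \<in> I" "j \<in> I" "i \<noteq> j" "a \<in> A i" "b \<in> A j" for i j a b
  proof (rule normal_disjoint_commute)
    have "A j \<subseteq> generate G (\<Union>j \<in> I - {i}. A j)"
      using that by (auto intro: generate.incl)
    moreover have "A i \<inter> generate G (\<Union>j \<in> I - {i}. A j) = {\<one>}"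
      using idp that by (auto simp: internal_direct_product_def)
    moreover have "\<one> \<in> A i" "\<one> \<in> A j"
      using char that by (auto simp: characteristic_def dest: subgroup.one_closed)
    ultimately show "A i \<inter> A j = {\<one>}" by blast
  qed (use that char characteristic_imp_normal in auto)
  show "x \<otimes> y = y \<otimes> x"
    if "x \<in> generate G (\<Union>i \<in> S. A i)" "y \<in> generate G (\<Union>i \<in> I - S. A i)" for x y
  proof (rule generate_commute[OF _ _ _ that])
    show "(\<Union>i \<in> S. A i) \<subseteq> carrier G" "(\<Union>i \<in> I - S. A i) \<subseteq> carrier G"
      using S carr by auto
    fix h k assume "h \<in> (\<Union>i \<in> S. A i)" "k \<in> (\<Union>i \<in> I - S. A i)"
    then obtain i j where "i \<in> S" "h \<in> A i" "j \<in> I - S" "k \<in> A j" by auto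
    then show "h \<otimes> k = k \<otimes> h" using S by (intro comm[of i j]) auto
  qed
  show "characteristic (generate G (\<Union>i \<in> S. A i)) G"
    "characteristic (generate G (\<Union>i \<in> I - S. A i)) G"
    using char S by (auto intro!: characteristic_generate_UN)
qed (rule internal_direct_product_complement[OF idp S char])

text \<open>If \<open>i\<close> were in \<open>S\<close> but not in \<open>S'\<close>, then
  \<open>A i\<close> would lie in the subgroup generated by the other factors, which it meets
  trivially.\<close>

lemma internal_direct_product_parts_inj:
  assumes idp: "internal_direct_product G I A"
    and nontriv: "\<And>i. i \<in> I \<Longrightarrow> A i \<noteq> {\<one>}"
  shows "inj_on (\<lambda>S. generate G (\<Union>i \<in> S. A i)) (Pow I)"
proof -
  have "S \<subseteq> S'" if S: "S \<subseteq> I" "S' \<subseteq> I"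
    and eq: "generate G (\<Union>i \<in> S. A i) = generate G (\<Union>i \<in> S'. A i)" for S S'
  proof
    fix i assume i: "i \<in> S"
    then have iI: "i \<in> I" using S by auto
    then interpret N: normal "A i" G using idp by (simp add: internal_direct_product_def)
    show "i \<in> S'"
    proof (rule ccontr)
      assume "i \<notin> S'"
      then have "generate G (\<Union>i \<in> S'. A i) \<subseteq> generate G (\<Union>j \<in> I - {i}. A j)"
        using S by (intro mono_generate) auto
      moreover have "A i \<subseteq> generate G (\<Union>i \<in> S. A i)"
        using i by (auto intro: generate.incl)
      ultimately have "A i \<subseteq> {\<one>}"
        using idp eq iI unfolding internal_direct_product_def by blast
      then show False using nontriv[OF iI] N.one_closed by blast
    qed
  qed
  then show ?thesis by (intro inj_onI) (simp add: set_eq_subset)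
qed

text \<open>Perfectness splits \<open>A i\<close> into its intersections with \<open>U\<close> and
  \<open>V\<close>. Both are characteristic in \<open>G\<close>, so indecomposability makes one of
  them trivial.\<close>

lemma KRS_factor_subset:
  assumes perfect: "perfect_group G" and krs: "KRS_decomposition G n A"
    and UV: "characteristic_decomposition G U V" and i: "i \<in> {1..n}"
  shows "A i \<subseteq> U \<or> A i \<subseteq> V"
proof -
  have idp: "internal_direct_product G {1..n} A"
    and char: "\<And>i. i \<in> {1..n} \<Longrightarrow> characteristic (A i) G"
    using krs by (auto simp: KRS_decomposition_def)
  have U: "characteristic U G" and V: "characteristic V G"
    using UV by (auto simp: characteristic_decomposition_def)
  let ?B = "A i \<inter> U" and ?C = "A i \<inter> V"
  define H where "H = G\<lparr>carrier := A i\<rparr>"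
  have B: "characteristic ?B G" and C: "characteristic ?C G"
    using U V char[OF i] by (auto intro: characteristic_Int)
  interpret Ai: normal "A i" G using char[OF i] by (rule characteristic_imp_normal)
  interpret Bs: normal ?B G using B by (rule characteristic_imp_normal)
  interpret Cs: normal ?C G using C by (rule characteristic_imp_normal)
  \<comment> \<open>The direct complement of \<open>A i\<close> is the subgroup generated by the
    remaining factors.\<close>
  have "A i \<inter> generate G (\<Union>j \<in> {1..n} - {i}. A j) = {\<one>}"
    using idp i unfolding internal_direct_product_def by blast
  moreover have "generate G (A i) = A i"
    using generateI[OF Ai.subgroup_axioms, of "A i"] by auto
  ultimately have split: "?B <#> ?C = A i"
    using internal_direct_product_complement[OF idp _ char, of "{i}"] i U V UV
      characteristic_generate_UN[of "{1..n} - {i}" A] char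
    by (intro perfect_direct_factor_splits[OF perfect,
          where C = "generate G (\<Union>j \<in> {1..n} - {i}. A j)"])
      (auto intro!: characteristic_imp_normal simp: characteristic_decomposition_def)
  have BC: "?B \<inter> ?C = {\<one>}"
    using UV Bs.one_closed Cs.one_closed by (auto simp: characteristic_decomposition_def)
  have gen: "generate G K = K" if "subgroup K G" for K
    using generateI[OF that, of K] by auto
  \<comment> \<open>Indecomposability is phrased through a family indexed by \<open>bool\<close>
    inside the restricted group; removing one index leaves only the other factor, and generation
    there agrees with generation in \<open>G\<close>.\<close>
  have "internal_direct_product H UNIV (case_bool ?B ?C)"
    unfolding internal_direct_product_def
  proof (intro conjI ballI)
    fix b :: bool
    show "case_bool ?B ?C b \<lhd> H"
      unfolding H_def by (cases b) (simp_all add: normal_restrict_supergroup Ai.subgroup_axioms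
          Bs.normal_axioms Cs.normal_axioms)
    have compl: "(UNIV - {b}) = {\<not> b}" by auto
    have "generate H (case_bool ?B ?C (\<not> b)) = case_bool ?B ?C (\<not> b)"
      unfolding H_def
      by (cases b) (simp_all add: generate_consistent Ai.subgroup_axioms gen
          Bs.subgroup_axioms Cs.subgroup_axioms)
    then show "case_bool ?B ?C b \<inter> generate H (\<Union>j \<in> UNIV - {b}. case_bool ?B ?C j) = {\<one>\<^bsub>H\<^esub>}"
      unfolding compl using BC by (cases b) (auto simp: H_def)
  next
    have "?B <#> ?C \<subseteq> generate G (?B \<union> ?C)"
      by (auto simp: set_mult_def intro!: generate.eng intro: generate.incl)
    then have "generate G (?B \<union> ?C) = A i"
      using split generate_subgroup_incl[OF _ Ai.subgroup_axioms, of "?B \<union> ?C"] by auto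
    then show "generate H (\<Union>b \<in> UNIV. case_bool ?B ?C b) = carrier H"
      using generate_consistent[OF _ Ai.subgroup_axioms, of "?B \<union> ?C"]
      by (simp add: H_def UNIV_bool Un_commute)
  qed
  then have "?B = {\<one>} \<or> ?C = {\<one>}"
    using krs i B C unfolding KRS_decomposition_def H_def by blast
  then show ?thesis
  proof
    assume "?B = {\<one>}"
    then have "A i = ?C" using split by (auto simp: set_mult_def)
    then show ?thesis by auto
  next
    assume "?C = {\<one>}"
    then have "A i = ?B" using split by (auto simp: set_mult_def)
    then show ?thesis by auto
  qed
qed

text \<open>The set \<open>S\<close> collects the factors inside \<open>U\<close>; all others lie in
  \<open>V\<close>. The two parts already multiply to \<open>G\<close>, so disjointness of
  \<open>U\<close> and \<open>V\<close> leaves no room for strict inclusions.\<close>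

lemma characteristic_decomposition_eq_parts:
  assumes perfect: "perfect_group G" and krs: "KRS_decomposition G n A"
    and UV: "characteristic_decomposition G U V"
  shows "\<exists>S \<subseteq> {1..n}. U = generate G (\<Union>i \<in> S. A i) \<and> V = generate G (\<Union>i \<in> {1..n} - S. A i)"
proof -
  have idp: "internal_direct_product G {1..n} A"
    and char: "\<And>i. i \<in> {1..n} \<Longrightarrow> characteristic (A i) G"
    using krs by (auto simp: KRS_decomposition_def)
  interpret U: subgroup U G
    using UV by (simp add: characteristic_decomposition_def characteristic_def)
  interpret V: subgroup V G
    using UV by (simp add: characteristic_decomposition_def characteristic_def)
  have disj: "U \<inter> V = {\<one>}" using UV by (simp add: characteristic_decomposition_def)
  define S where "S = {i \<in> {1..n}. A i \<subseteq> U}"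
  let ?U = "generate G (\<Union>i \<in> S. A i)" and ?V = "generate G (\<Union>i \<in> {1..n} - S. A i)"
  have UU: "?U \<subseteq> U"
    by (intro generate_subgroup_incl U.subgroup_axioms) (auto simp: S_def)
  have VV: "?V \<subseteq> V"
    using KRS_factor_subset[OF perfect krs UV]
    by (intro generate_subgroup_incl V.subgroup_axioms) (unfold S_def, blast)
  have prod: "?U <#> ?V = carrier G"
    by (rule internal_direct_product_complement[OF idp _ char]) (auto simp: S_def)
  \<comment> \<open>Write \<open>x\<close> as a product over the two parts; the component in
    \<open>?V\<close> then lies in \<open>U \<inter> V\<close>.\<close>
  have U: "x \<in> ?U" if x: "x \<in> U" for x
  proof -
    obtain a b where ab: "a \<in> ?U" "b \<in> ?V" "x = a \<otimes> b"
      using set_mult_carrierE[OF prod U.mem_carrier[OF x]] by metis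
    then have a: "a \<in> U" and b: "b \<in> V" using UU VV by auto
    then have "b = inv a \<otimes> x" by (simp add: ab)
    then have "b \<in> U \<inter> V" using U.m_closed[OF U.m_inv_closed[OF a] x] b by simp
    then have "b = \<one>" using disj by auto
    then show ?thesis using ab a by simp
  qed
  have V: "y \<in> ?V" if y: "y \<in> V" for y
  proof -
    obtain a b where ab: "a \<in> ?U" "b \<in> ?V" "y = a \<otimes> b"
      using set_mult_carrierE[OF prod V.mem_carrier[OF y]] by metis
    then have a: "a \<in> U" and b: "b \<in> V" using UU VV by auto
    then have "a = y \<otimes> inv b" by (simp add: ab m_assoc)
    then have "a \<in> U \<inter> V" using V.m_closed[OF y V.m_inv_closed[OF b]] a by simp
    then have "a = \<one>" using disj by auto
    then show ?thesis using ab b by simp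
  qed
  show ?thesis
    using U V UU VV by (intro exI[of _ S]) (auto simp: S_def)
qed

end

section \<open>Regular normal subgroups of the holomorph\<close>

lemma carrier_BijGroup: "carrier (BijGroup E) = Bij E"
  by (simp add: BijGroup_def)

lemma Bij_apply: "f \<in> Bij E \<Longrightarrow> x \<in> E \<Longrightarrow> f x \<in> E"
  by (auto dest: Bij_imp_funcset)

lemma Bij_eqI:
  assumes "f \<in> Bij E" "g \<in> Bij E" "\<And>x. x \<in> E \<Longrightarrow> f x = g x"
  shows "f = g"
  using assms by (intro extensionalityI[of _ E]) (auto dest: Bij_imp_extensional)

lemma BijGroup_mult_apply:
  "f \<in> Bij E \<Longrightarrow> g \<in> Bij E \<Longrightarrow> x \<in> E \<Longrightarrow> (f \<otimes>\<^bsub>BijGroup E\<^esub> g) x = f (g x)"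
  by (simp add: BijGroup_def compose_def)

lemma BijGroup_one_apply: "x \<in> E \<Longrightarrow> \<one>\<^bsub>BijGroup E\<^esub> x = x"
  by (simp add: BijGroup_def)

lemma BijGroup_mult_closed: "f \<in> Bij E \<Longrightarrow> g \<in> Bij E \<Longrightarrow> f \<otimes>\<^bsub>BijGroup E\<^esub> g \<in> Bij E"
  by (simp add: BijGroup_def compose_Bij)

lemma BijGroup_inv_closed: "f \<in> Bij E \<Longrightarrow> inv\<^bsub>BijGroup E\<^esub> f \<in> Bij E"
  using group.inv_closed[OF group_BijGroup, of f E] by (simp add: carrier_BijGroup)

lemma BijGroup_inv_apply:
  assumes "f \<in> Bij E" "x \<in> E"
  shows "f ((inv\<^bsub>BijGroup E\<^esub> f) x) = x" "(inv\<^bsub>BijGroup E\<^esub> f) (f x) = x"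
proof -
  interpret group "BijGroup E" by (rule group_BijGroup)
  have "f ((inv\<^bsub>BijGroup E\<^esub> f) x) = (f \<otimes>\<^bsub>BijGroup E\<^esub> inv\<^bsub>BijGroup E\<^esub> f) x"
    using assms by (simp add: BijGroup_mult_apply BijGroup_inv_closed)
  then show "f ((inv\<^bsub>BijGroup E\<^esub> f) x) = x"
    using assms by (simp add: carrier_BijGroup BijGroup_one_apply)
  have "(inv\<^bsub>BijGroup E\<^esub> f) (f x) = (inv\<^bsub>BijGroup E\<^esub> f \<otimes>\<^bsub>BijGroup E\<^esub> f) x"
    using assms by (simp add: BijGroup_mult_apply BijGroup_inv_closed)
  then show "(inv\<^bsub>BijGroup E\<^esub> f) (f x) = x"
    using assms by (simp add: carrier_BijGroup BijGroup_one_apply)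
qed

text \<open>Computes a conjugate from an intertwining relation, so that inverse permutations never
  have to be evaluated.\<close>

lemma BijGroup_conjugate_eq:
  assumes "f \<in> Bij E" "g \<in> Bij E" "h \<in> Bij E" "\<And>x. x \<in> E \<Longrightarrow> f (g x) = h (f x)"
  shows "f \<otimes>\<^bsub>BijGroup E\<^esub> g \<otimes>\<^bsub>BijGroup E\<^esub> inv\<^bsub>BijGroup E\<^esub> f = h"
proof (rule Bij_eqI)
  fix x assume x: "x \<in> E"
  then have "(inv\<^bsub>BijGroup E\<^esub> f) x \<in> E"
    using assms by (simp add: Bij_apply BijGroup_inv_closed)
  then show "(f \<otimes>\<^bsub>BijGroup E\<^esub> g \<otimes>\<^bsub>BijGroup E\<^esub> inv\<^bsub>BijGroup E\<^esub> f) x = h x"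
    using x assms
    by (simp add: BijGroup_mult_apply BijGroup_inv_closed BijGroup_mult_closed BijGroup_inv_apply)
qed (use assms in \<open>simp_all add: BijGroup_inv_closed BijGroup_mult_closed\<close>)

text \<open>Replaces group actions by transitivity and freeness on points. A stabilizer always
  contains the identity, so its triviality is the last implication.\<close>

lemma regular_subgroup_iff:
  "regular_subgroup N E \<longleftrightarrow> subgroup N (BijGroup E) \<and>
     (\<forall>x \<in> E. \<forall>y \<in> E. \<exists>f \<in> N. f x = y) \<and> (\<forall>x \<in> E. \<forall>f \<in> N. f x = x \<longrightarrow> f = \<one>\<^bsub>BijGroup E\<^esub>)"
proof (cases "subgroup N (BijGroup E)")
  case True
  interpret Sym: group "BijGroup E" by (rule group_BijGroup)
  interpret N: subgroup N "BijGroup E" by fact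
  interpret NG: group "(BijGroup E)\<lparr>carrier := N\<rparr>" using True by (rule Sym.subgroup_imp_group)
  have "group_action ((BijGroup E)\<lparr>carrier := N\<rparr>) E (\<lambda>f. f)"
    by unfold_locales (auto simp: hom_def)
  then have "transitive_action ((BijGroup E)\<lparr>carrier := N\<rparr>) E (\<lambda>f. f)
    \<longleftrightarrow> (\<forall>x \<in> E. \<forall>y \<in> E. \<exists>f \<in> N. f x = y)"
    by (auto simp: transitive_action_def transitive_action_axioms_def)
  moreover have "stabilizer ((BijGroup E)\<lparr>carrier := N\<rparr>) (\<lambda>f. f) x = {\<one>\<^bsub>BijGroup E\<^esub>}
    \<longleftrightarrow> (\<forall>f \<in> N. f x = x \<longrightarrow> f = \<one>\<^bsub>BijGroup E\<^esub>)" if "x \<in> E" for x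
    using that BijGroup_one_apply[OF that] N.one_closed by (auto simp: stabilizer_def)
  ultimately show ?thesis
    using True by (simp add: regular_subgroup_def)
qed (simp add: regular_subgroup_def)

lemma regular_subgroup_conjugate:
  assumes N: "regular_subgroup N E" and t: "t \<in> Bij E"
  shows "regular_subgroup ((\<lambda>k. t \<otimes>\<^bsub>BijGroup E\<^esub> k \<otimes>\<^bsub>BijGroup E\<^esub> inv\<^bsub>BijGroup E\<^esub> t) ` N) E"
    (is "regular_subgroup (?c ` N) E")
  unfolding regular_subgroup_iff
proof (intro conjI ballI impI)
  interpret Sym: group "BijGroup E" by (rule group_BijGroup)
  have sub: "subgroup N (BijGroup E)" using N by (simp add: regular_subgroup_iff)
  then have NB: "f \<in> Bij E" if "f \<in> N" for f
    using subgroup.mem_carrier[OF sub that] by (simp add: carrier_BijGroup)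
  have app: "?c f x = t (f ((inv\<^bsub>BijGroup E\<^esub> t) x))" if "f \<in> N" "x \<in> E" for f x
    using NB[OF that(1)] that(2) t
    by (simp add: BijGroup_mult_apply BijGroup_mult_closed BijGroup_inv_closed Bij_apply)
  have ic: "(inv\<^bsub>BijGroup E\<^esub> t) x \<in> E" if "x \<in> E" for x
    using t that by (simp add: BijGroup_inv_closed Bij_apply)
  show "subgroup (?c ` N) (BijGroup E)"
    using sub t by (intro Sym.subgroup_conjugate_image) (simp_all add: carrier_BijGroup)
  fix x assume x: "x \<in> E"
  show "\<exists>f \<in> ?c ` N. f x = y" if y: "y \<in> E" for y
  proof -
    obtain f where "f \<in> N" "f ((inv\<^bsub>BijGroup E\<^esub> t) x) = (inv\<^bsub>BijGroup E\<^esub> t) y"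
      using N ic[OF x] ic[OF y] unfolding regular_subgroup_iff by blast
    then have "f \<in> N" "?c f x = y"
      using t x y by (simp_all add: app BijGroup_inv_apply)
    then show ?thesis by blast
  qed
  fix f assume "f \<in> ?c ` N" and fx: "f x = x"
  then obtain k where k: "k \<in> N" "f = ?c k" by auto
  then have "t (k ((inv\<^bsub>BijGroup E\<^esub> t) x)) = x" using app fx x by simp
  then have "k ((inv\<^bsub>BijGroup E\<^esub> t) x) = (inv\<^bsub>BijGroup E\<^esub> t) x"
    using BijGroup_inv_apply(2)[OF t, of "k ((inv\<^bsub>BijGroup E\<^esub> t) x)"] ic[OF x] NB[OF k(1)]
    by (simp add: Bij_apply)
  then have "k = \<one>\<^bsub>BijGroup E\<^esub>"
    using N k(1) ic[OF x] unfolding regular_subgroup_iff by blast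
  then show "f = \<one>\<^bsub>BijGroup E\<^esub>"
    using k t by (simp add: carrier_BijGroup)
qed

text \<open>One family containing the left translations (\<open>a\<close> trivial) and the right
  translations (\<open>b\<close> trivial). Under composition the left parameters multiply in order,
  the right ones in reverse order.\<close>

definition two_sided :: "('a, 'b) monoid_scheme \<Rightarrow> 'a \<Rightarrow> 'a \<Rightarrow> 'a \<Rightarrow> 'a" where
  "two_sided G b a = (\<lambda>x \<in> carrier G. b \<otimes>\<^bsub>G\<^esub> x \<otimes>\<^bsub>G\<^esub> a)"

section \<open>Translations and the holomorph\<close>

context group
begin

interpretation Sym: group "Sym G"
  by (rule group_BijGroup)

lemma two_sided_Bij:
  assumes "b \<in> carrier G" "a \<in> carrier G"
  shows "two_sided G b a \<in> Bij (carrier G)"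
proof -
  have "bij_betw (two_sided G b a) (carrier G) (carrier G)"
    by (rule bij_betw_byWitness[where f' = "\<lambda>x. inv b \<otimes> x \<otimes> inv a"])
      (use assms in \<open>auto simp: two_sided_def m_assoc\<close>)
  then show ?thesis by (simp add: Bij_def two_sided_def)
qed

lemma two_sided_apply:
  "x \<in> carrier G \<Longrightarrow> two_sided G b a x = b \<otimes> x \<otimes> a"
  by (simp add: two_sided_def)

lemma two_sided_mult:
  assumes "b \<in> carrier G" "a \<in> carrier G" "b' \<in> carrier G" "a' \<in> carrier G"
  shows "two_sided G b a \<otimes>\<^bsub>Sym G\<^esub> two_sided G b' a' = two_sided G (b \<otimes> b') (a' \<otimes> a)"
  by (rule Bij_eqI[of _ "carrier G"])
    (use assms in \<open>simp_all add: two_sided_Bij BijGroup_mult_closed BijGroup_mult_apply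
      two_sided_apply m_assoc\<close>)

lemma two_sided_one: "two_sided G \<one> \<one> = \<one>\<^bsub>Sym G\<^esub>"
  by (rule Bij_eqI[of _ "carrier G"])
    (simp_all add: two_sided_Bij two_sided_apply BijGroup_one_apply BijGroup_def id_Bij)

lemma two_sided_inv:
  assumes "b \<in> carrier G" "a \<in> carrier G"
  shows "inv\<^bsub>Sym G\<^esub> (two_sided G b a) = two_sided G (inv b) (inv a)"
  using assms
  by (intro Sym.inv_equality)
    (simp_all add: two_sided_mult two_sided_one two_sided_Bij carrier_BijGroup)

lemma right_regular_eq_two_sided: "g \<in> carrier G \<Longrightarrow> right_regular G g = two_sided G \<one> g"
  by (auto simp: right_regular_def two_sided_def)

lemma right_regular_image: "right_regular G ` carrier G = two_sided G \<one> ` carrier G"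
  by (simp add: right_regular_eq_two_sided)

lemma regular_right_regular: "regular_subgroup (right_regular G ` carrier G) (carrier G)"
  unfolding regular_subgroup_iff right_regular_image
proof (intro conjI ballI impI)
  show "subgroup (two_sided G \<one> ` carrier G) (Sym G)"
  proof (rule subgroup.intro)
    show "\<one>\<^bsub>Sym G\<^esub> \<in> two_sided G \<one> ` carrier G"
      by (metis two_sided_one imageI one_closed)
  qed (auto simp: two_sided_Bij carrier_BijGroup two_sided_mult two_sided_inv)
  show "\<exists>f \<in> two_sided G \<one> ` carrier G. f x = y" if "x \<in> carrier G" "y \<in> carrier G" for x y
    using that by (intro bexI[of _ "two_sided G \<one> (inv x \<otimes> y)"]) (auto simp: two_sided_apply)
  show "f = \<one>\<^bsub>Sym G\<^esub>" if "x \<in> carrier G" "f \<in> two_sided G \<one> ` carrier G" "f x = x" for x f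
    using that by (auto simp: two_sided_apply two_sided_one)
qed

lemma subgroup_right_regular: "subgroup (right_regular G ` carrier G) (Sym G)"
  using regular_right_regular by (simp add: regular_subgroup_iff)

lemma right_regular_iso: "G \<cong> (Sym G)\<lparr>carrier := right_regular G ` carrier G\<rparr>"
proof -
  \<comment> \<open>With functions written on the left, right translation reverses products;
    inserting the inverse turns it into a homomorphism.\<close>
  have "inj_on (\<lambda>g. two_sided G \<one> (inv g)) (carrier G)"
  proof (rule inj_onI)
    fix g h assume "g \<in> carrier G" "h \<in> carrier G"
      and "two_sided G \<one> (inv g) = two_sided G \<one> (inv h)"
    then show "g = h"
      by (metis two_sided_apply one_closed inv_closed l_one inv_inv)
  qed
  moreover have "(\<lambda>g. two_sided G \<one> (inv g)) ` carrier G = two_sided G \<one> ` carrier G"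
    by (force intro: image_eqI[of _ _ "inv _"])
  moreover have "two_sided G \<one> (inv (g \<otimes> h))
      = two_sided G \<one> (inv g) \<otimes>\<^bsub>Sym G\<^esub> two_sided G \<one> (inv h)"
    if "g \<in> carrier G" "h \<in> carrier G" for g h
    using that by (simp add: two_sided_mult inv_mult_group)
  ultimately have "(\<lambda>g. two_sided G \<one> (inv g))
      \<in> iso G ((Sym G)\<lparr>carrier := two_sided G \<one> ` carrier G\<rparr>)"
    by (auto simp: iso_def hom_def bij_betw_def)
  then show ?thesis
    unfolding right_regular_image is_iso_def by blast
qed

lemma subgroup_Hol: "subgroup (Hol G) (Sym G)"
  unfolding Hol_def using subgroup_right_regular
  by (intro Sym.normalizer_imp_subgroup subgroup.subset)

lemma subgroup_NHol: "subgroup (NHol G) (Sym G)"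
  unfolding NHol_def using subgroup_Hol
  by (intro Sym.normalizer_imp_subgroup subgroup.subset)

lemma Hol_Bij: "f \<in> Hol G \<Longrightarrow> f \<in> Bij (carrier G)"
  using subgroup.mem_carrier[OF subgroup_Hol] by (simp add: carrier_BijGroup)

lemma right_regular_normal_Hol: "right_regular G ` carrier G \<lhd> (Sym G)\<lparr>carrier := Hol G\<rparr>"
  unfolding Hol_def using subgroup_right_regular by (rule Sym.subgroup_in_normalizer)

lemma auto_Bij: "\<phi> \<in> auto G \<Longrightarrow> \<phi> \<in> Bij (carrier G)"
  by (simp add: auto_def)

lemma auto_one: "\<phi> \<in> auto G \<Longrightarrow> \<phi> \<one> = \<one>"
  using group_hom.hom_one auto_group_hom by blast

text \<open>Conjugating right translation by \<open>k\<close> with an automorphism gives right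
  translation by the image of \<open>k\<close>.\<close>

lemma auto_subset_Hol: "auto G \<subseteq> Hol G"
proof
  fix \<phi> assume \<phi>: "\<phi> \<in> auto G"
  have "\<phi> \<otimes>\<^bsub>Sym G\<^esub> right_regular G k \<otimes>\<^bsub>Sym G\<^esub> inv\<^bsub>Sym G\<^esub> \<phi> = right_regular G (\<phi> k)"
    if "k \<in> carrier G" for k
    using \<phi> that
    by (intro BijGroup_conjugate_eq)
      (simp_all add: right_regular_eq_two_sided two_sided_Bij two_sided_apply auto_Bij auto_closed auto_mult)
  then have "(\<lambda>f. \<phi> \<otimes>\<^bsub>Sym G\<^esub> f \<otimes>\<^bsub>Sym G\<^esub> inv\<^bsub>Sym G\<^esub> \<phi>) ` right_regular G ` carrier G
    = right_regular G ` \<phi> ` carrier G"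
    by (simp add: image_image)
  moreover have "\<phi> ` carrier G = carrier G"
    using auto_Bij[OF \<phi>] by (simp add: Bij_def bij_betw_def)
  ultimately show "\<phi> \<in> Hol G"
    unfolding Hol_def Sym.normalizer_eq[OF subgroup.subset[OF subgroup_right_regular]]
    using auto_Bij[OF \<phi>] by (simp add: carrier_BijGroup)
qed

text \<open>The equality of \<open>Hol G\<close> with the product of \<open>auto G\<close> and the
  right translations. Normalizing the translations means that
  \<open>f (x \<otimes> k) = f x \<otimes> k'\<close> with \<open>k'\<close> independent of
  \<open>x\<close>; dividing by the value at the identity leaves an automorphism.\<close>

lemma mem_Hol_iff:
  "f \<in> Hol G \<longleftrightarrow> (\<exists>\<phi> \<in> auto G. \<exists>g \<in> carrier G. f = (\<lambda>x \<in> carrier G. \<phi> x \<otimes> g))"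
proof
  assume f: "f \<in> Hol G"
  then have fB: "f \<in> Bij (carrier G)" by (rule Hol_Bij)
  then have fc [simp]: "f x \<in> carrier G" if "x \<in> carrier G" for x
    using that by (simp add: Bij_apply)
  define \<phi> where "\<phi> = (\<lambda>x \<in> carrier G. f x \<otimes> inv (f \<one>))"
  have shift: "\<exists>k' \<in> carrier G. \<forall>x \<in> carrier G. f (x \<otimes> k) = f x \<otimes> k'" if k: "k \<in> carrier G" for k
  proof -
    have "f \<otimes>\<^bsub>Sym G\<^esub> right_regular G k \<otimes>\<^bsub>Sym G\<^esub> inv\<^bsub>Sym G\<^esub> f \<in> right_regular G ` carrier G"
      using right_regular_normal_Hol f k unfolding Sym.normal_restrict_iff[OF subgroup_Hol] by blast
    then obtain k' where k': "k' \<in> carrier G"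
      "f \<otimes>\<^bsub>Sym G\<^esub> two_sided G \<one> k \<otimes>\<^bsub>Sym G\<^esub> inv\<^bsub>Sym G\<^esub> f = two_sided G \<one> k'"
      using k by (auto simp: right_regular_eq_two_sided)
    have "f (x \<otimes> k) = f x \<otimes> k'" if x: "x \<in> carrier G" for x
    proof -
      have "(f \<otimes>\<^bsub>Sym G\<^esub> two_sided G \<one> k \<otimes>\<^bsub>Sym G\<^esub> inv\<^bsub>Sym G\<^esub> f) (f x) = f (x \<otimes> k)"
        using fB k x
        by (simp add: BijGroup_mult_apply BijGroup_mult_closed BijGroup_inv_closed
            BijGroup_inv_apply two_sided_Bij two_sided_apply)
      then show ?thesis using k' x by (simp add: two_sided_apply)
    qed
    then show ?thesis using k' by blast
  qed
  have mult: "\<phi> (x \<otimes> k) = \<phi> x \<otimes> \<phi> k" if "x \<in> carrier G" "k \<in> carrier G" for x k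
  proof -
    obtain k' where k': "k' \<in> carrier G" "\<And>x. x \<in> carrier G \<Longrightarrow> f (x \<otimes> k) = f x \<otimes> k'"
      using shift \<open>k \<in> carrier G\<close> by blast
    \<comment> \<open>Evaluation at the identity determines \<open>k'\<close>.\<close>
    have "f k = f \<one> \<otimes> k'" using k'(2)[of \<one>] that by simp
    then show ?thesis
      using that k' by (simp add: \<phi>_def m_assoc)
  qed
  have "\<phi> = two_sided G \<one> (inv (f \<one>)) \<otimes>\<^bsub>Sym G\<^esub> f"
    using fB by (auto simp: \<phi>_def BijGroup_def two_sided_Bij compose_def two_sided_apply fun_eq_iff)
  then have "\<phi> \<in> Bij (carrier G)"
    using fB by (simp add: BijGroup_mult_closed two_sided_Bij)
  then have "\<phi> \<in> auto G"
    using mult by (auto simp: auto_def hom_def Bij_apply)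
  moreover have "f = (\<lambda>x \<in> carrier G. \<phi> x \<otimes> f \<one>)"
    using Bij_imp_extensional[OF fB]
    by (intro extensionalityI[of _ "carrier G"]) (auto simp: \<phi>_def m_assoc)
  ultimately show "\<exists>\<phi> \<in> auto G. \<exists>g \<in> carrier G. f = (\<lambda>x \<in> carrier G. \<phi> x \<otimes> g)"
    using fc by blast
next
  assume "\<exists>\<phi> \<in> auto G. \<exists>g \<in> carrier G. f = (\<lambda>x \<in> carrier G. \<phi> x \<otimes> g)"
  then obtain \<phi> g where \<phi>: "\<phi> \<in> auto G" and g: "g \<in> carrier G"
    and f: "f = (\<lambda>x \<in> carrier G. \<phi> x \<otimes> g)" by blast
  have "f = right_regular G g \<otimes>\<^bsub>Sym G\<^esub> \<phi>"
    using \<phi> g auto_Bij[OF \<phi>]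
    by (auto simp: f BijGroup_def two_sided_Bij right_regular_eq_two_sided compose_def
        two_sided_apply fun_eq_iff auto_closed)
  moreover have "right_regular G g \<in> Hol G"
    using right_regular_normal_Hol g unfolding Sym.normal_restrict_iff[OF subgroup_Hol] by blast
  ultimately show "f \<in> Hol G"
    using \<phi> auto_subset_Hol subgroup.m_closed[OF subgroup_Hol] by auto
qed

lemma HolE:
  assumes "f \<in> Hol G"
  obtains \<phi> g where "\<phi> \<in> auto G" "g \<in> carrier G" "\<And>x. x \<in> carrier G \<Longrightarrow> f x = \<phi> x \<otimes> g"
  using assms unfolding mem_Hol_iff by auto

text \<open>The map is an inner automorphism followed by a right translation:
  \<open>b x a = (b x b^-1) (b a)\<close>.\<close>

lemma two_sided_Hol:
  assumes "b \<in> carrier G" "a \<in> carrier G"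
  shows "two_sided G b a \<in> Hol G"
  unfolding mem_Hol_iff
proof (intro bexI)
  show "two_sided G b a = (\<lambda>x \<in> carrier G. (\<lambda>x \<in> carrier G. b \<otimes> x \<otimes> inv b) x \<otimes> (b \<otimes> a))"
    using assms by (auto simp: two_sided_def fun_eq_iff m_assoc)
  show "b \<otimes> a \<in> carrier G" using assms by simp
qed (rule conjugation_auto[OF assms(1)])

text \<open>The normalizer of the conjugate is the conjugate of \<open>Hol G\<close>, and
  \<open>t\<close> leaves \<open>Hol G\<close> fixed.\<close>

lemma NHol_conjugate_in_HH:
  assumes t: "t \<in> NHol G"
  shows "(\<lambda>k. t \<otimes>\<^bsub>Sym G\<^esub> k \<otimes>\<^bsub>Sym G\<^esub> inv\<^bsub>Sym G\<^esub> t) ` right_regular G ` carrier G \<in> HH G"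
    (is "?N \<in> _")
proof -
  have tS: "t \<in> carrier (Sym G)"
    using t subgroup.mem_carrier[OF subgroup_NHol] by blast
  note R = subgroup_right_regular
  have "regular_subgroup ?N (carrier G)"
    using regular_subgroup_conjugate[OF regular_right_regular, of t] tS by (simp add: carrier_BijGroup)
  moreover have "G \<cong> (Sym G)\<lparr>carrier := ?N\<rparr>"
    using iso_trans[OF right_regular_iso Sym.conjugate_image_iso[OF R tS]] .
  then have "(Sym G)\<lparr>carrier := ?N\<rparr> \<cong> G"
    by (rule iso_sym)
  moreover have "normalizer (Sym G) ?N = Hol G"
    using Sym.normalizer_conjugate_image[OF subgroup.subset[OF R] tS] t
    by (simp add: NHol_def Hol_def[symmetric] Sym.normalizer_eq[OF subgroup.subset[OF subgroup_Hol]])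
  ultimately show ?thesis by (simp add: HH_def)
qed

text \<open>A subgroup is normal in its normalizer.\<close>

lemma HH_subset_JJ: "HH G \<subseteq> JJ G"
proof
  fix N assume "N \<in> HH G"
  then show "N \<in> JJ G"
    using Sym.subgroup_in_normalizer[of N] by (auto simp: HH_def JJ_def regular_subgroup_def)
qed

section \<open>The shape of a regular normal subgroup of the holomorph\<close>

lemma JJ_imp_decomposition:
  assumes perfect: "perfect_group G" and center: "center G = {\<one>}" and N: "N \<in> JJ G"
  shows "\<exists>U V. characteristic_decomposition G U V \<and> N = (\<lambda>(a, b). two_sided G b a) ` (U \<times> V)"
proof -
  have Nsub: "subgroup N (Sym G)"
    and trans: "\<And>x y. x \<in> carrier G \<Longrightarrow> y \<in> carrier G \<Longrightarrow> \<exists>f \<in> N. f x = y"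
    and free: "\<And>x f. x \<in> carrier G \<Longrightarrow> f \<in> N \<Longrightarrow> f x = x \<Longrightarrow> f = \<one>\<^bsub>Sym G\<^esub>"
    using N by (auto simp: JJ_def regular_subgroup_iff)
  have NHol: "N \<subseteq> Hol G"
    and conj: "\<And>h k. h \<in> Hol G \<Longrightarrow> k \<in> N \<Longrightarrow> h \<otimes>\<^bsub>Sym G\<^esub> k \<otimes>\<^bsub>Sym G\<^esub> inv\<^bsub>Sym G\<^esub> h \<in> N"
    using N by (auto simp: JJ_def Sym.normal_restrict_iff[OF subgroup_Hol])
  interpret N: subgroup N "Sym G" by fact
  define U where "U = {a \<in> carrier G. two_sided G \<one> a \<in> N}"
  define V where "V = {b \<in> carrier G. two_sided G b \<one> \<in> N}"
  have "subgroup U G"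
  proof (rule subgroup.intro)
    show "x \<otimes> y \<in> U" if "x \<in> U" "y \<in> U" for x y
      using that N.m_closed[of "two_sided G \<one> y" "two_sided G \<one> x"] by (simp add: U_def two_sided_mult)
    show "inv x \<in> U" if "x \<in> U" for x
      using that N.m_inv_closed[of "two_sided G \<one> x"] by (simp add: U_def two_sided_inv)
    show "\<one> \<in> U" using N.one_closed by (simp add: U_def two_sided_one)
  qed (auto simp: U_def)
  have "subgroup V G"
  proof (rule subgroup.intro)
    show "x \<otimes> y \<in> V" if "x \<in> V" "y \<in> V" for x y
      using that N.m_closed[of "two_sided G x \<one>" "two_sided G y \<one>"] by (simp add: V_def two_sided_mult)
    show "inv x \<in> V" if "x \<in> V" for x
      using that N.m_inv_closed[of "two_sided G x \<one>"] by (simp add: V_def two_sided_inv)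
    show "\<one> \<in> V" using N.one_closed by (simp add: V_def two_sided_one)
  qed (auto simp: V_def)
  have auto_conj: "\<phi> \<otimes>\<^bsub>Sym G\<^esub> two_sided G b a \<otimes>\<^bsub>Sym G\<^esub> inv\<^bsub>Sym G\<^esub> \<phi> = two_sided G (\<phi> b) (\<phi> a)"
    if "\<phi> \<in> auto G" "a \<in> carrier G" "b \<in> carrier G" for \<phi> a b
    using that
    by (intro BijGroup_conjugate_eq)
      (simp_all add: two_sided_Bij two_sided_apply auto_Bij auto_closed auto_mult)
  \<comment> \<open>Closure under automorphisms gives invariance, because the inverse of an
    automorphism is one too.\<close>
  have charI: "characteristic H G"
    if H: "subgroup H G" and cl: "\<And>\<phi> h. \<phi> \<in> auto G \<Longrightarrow> h \<in> H \<Longrightarrow> \<phi> h \<in> H" for H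
    unfolding characteristic_def
  proof (intro conjI ballI H equalityI subsetI)
    fix \<phi> h assume \<phi>: "\<phi> \<in> auto G" and h: "h \<in> H"
    have hc: "h \<in> carrier G" using h subgroup.mem_carrier[OF H] by blast
    have "inv\<^bsub>Sym G\<^esub> \<phi> \<in> auto G"
      using \<phi> subgroup.m_inv_closed[OF subgroup_auto] by blast
    then have "(inv\<^bsub>Sym G\<^esub> \<phi>) h \<in> H" using cl h by blast
    moreover have "\<phi> ((inv\<^bsub>Sym G\<^esub> \<phi>) h) = h"
      using auto_Bij[OF \<phi>] hc by (simp add: BijGroup_inv_apply)
    ultimately show "h \<in> \<phi> ` H" by force
  qed (use cl in auto)
  have U: "characteristic U G"
    using conj auto_conj auto_subset_Hol
    by (intro charI[OF \<open>subgroup U G\<close>]) (fastforce simp: U_def auto_closed auto_one)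
  have V: "characteristic V G"
    using conj auto_conj auto_subset_Hol
    by (intro charI[OF \<open>subgroup V G\<close>]) (fastforce simp: V_def auto_closed auto_one)
  have UI: "a \<in> U" if "a \<in> carrier G" "two_sided G \<one> a \<in> N" for a
    using that by (simp add: U_def)
  have VI: "b \<in> V" if "b \<in> carrier G" "two_sided G b \<one> \<in> N" for b
    using that by (simp add: V_def)
  have UD: "two_sided G \<one> a \<in> N" if "a \<in> U" for a
    using that by (simp add: U_def)
  have VD: "two_sided G b \<one> \<in> N" if "b \<in> V" for b
    using that by (simp add: V_def)
  interpret U: normal U G using U by (rule characteristic_imp_normal)
  interpret V: normal V G using V by (rule characteristic_imp_normal)
  have comm_N: "f \<otimes>\<^bsub>Sym G\<^esub> h \<otimes>\<^bsub>Sym G\<^esub> inv\<^bsub>Sym G\<^esub> f \<otimes>\<^bsub>Sym G\<^esub> inv\<^bsub>Sym G\<^esub> h \<in> N"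
    if "f \<in> N" "h \<in> Hol G" for f h
  proof -
    have "f \<in> carrier (Sym G)" "h \<in> carrier (Sym G)"
      using that NHol by (auto simp: carrier_BijGroup Hol_Bij)
    then show ?thesis
      using N.m_closed[OF that(1) conj[OF that(2) N.m_inv_closed[OF that(1)]]]
      by (simp add: Sym.m_assoc)
  qed
  have comm: "a \<otimes> b \<otimes> inv a \<otimes> inv b \<in> V <#> U"
    if a: "a \<in> carrier G" and b: "b \<in> carrier G" for a b
  proof -
    \<comment> \<open>Transitivity lets the translation part of \<open>f\<close> be prescribed; the
      value \<open>inv b\<close> makes conjugation by \<open>b\<close> appear on the right side
      below.\<close>
    obtain f where f: "f \<in> N" "f \<one> = inv b"
      using trans[of \<one> "inv b"] b by auto
    then have fB: "f \<in> Bij (carrier G)" using NHol Hol_Bij by blast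
    obtain \<phi> g where \<phi>: "\<phi> \<in> auto G" and g: "g \<in> carrier G"
      and app: "\<And>x. x \<in> carrier G \<Longrightarrow> f x = \<phi> x \<otimes> g"
      using f NHol HolE by blast
    have gb: "g = inv b" using app[of \<one>] f g \<phi> by (simp add: auto_one)
    define c where "c = \<phi> (inv a)"
    have c: "c \<in> carrier G" using a \<phi> by (simp add: c_def auto_closed)
    \<comment> \<open>Conjugation by \<open>f\<close> turns left translation by \<open>inv a\<close>
      into left translation by \<open>c\<close>, so the commutator is left translation by
      \<open>c \<otimes> a\<close>.\<close>
    have "f \<otimes>\<^bsub>Sym G\<^esub> two_sided G (inv a) \<one> \<otimes>\<^bsub>Sym G\<^esub> inv\<^bsub>Sym G\<^esub> f = two_sided G c \<one>"
      using fB a c g \<phi>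
      by (intro BijGroup_conjugate_eq)
        (simp_all add: two_sided_Bij two_sided_apply app auto_mult auto_closed m_assoc c_def)
    then have "two_sided G (c \<otimes> a) \<one> \<in> N"
      using comm_N[OF f(1) two_sided_Hol[of "inv a" \<one>]] a c
      by (simp add: two_sided_inv two_sided_mult)
    then have v: "c \<otimes> a \<in> V" using a c by (intro VI m_closed)
    \<comment> \<open>On the right side the translation part of \<open>f\<close> enters as well, and
      the commutator gives an element of \<open>U\<close> built from the same
      \<open>c\<close>.\<close>
    have "f \<otimes>\<^bsub>Sym G\<^esub> two_sided G \<one> (inv a) \<otimes>\<^bsub>Sym G\<^esub> inv\<^bsub>Sym G\<^esub> f
      = two_sided G \<one> (b \<otimes> c \<otimes> inv b)"
      using fB a b c \<phi>
      by (intro BijGroup_conjugate_eq)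
        (simp_all add: two_sided_Bij two_sided_apply app auto_mult auto_closed m_assoc c_def gb)
    then have "two_sided G \<one> (a \<otimes> (b \<otimes> c \<otimes> inv b)) \<in> N"
      using comm_N[OF f(1) two_sided_Hol[of \<one> "inv a"]] a b c
      by (simp add: two_sided_inv two_sided_mult)
    then have u: "a \<otimes> (b \<otimes> c \<otimes> inv b) \<in> U" using a b c by (intro UI m_closed inv_closed)
    \<comment> \<open>Conjugated by \<open>a \<otimes> b\<close> and inverted, the element of
      \<open>V\<close> cancels the unknown \<open>c\<close> in the element of \<open>U\<close>; what
      remains is the commutator of \<open>a\<close> and \<open>b\<close>.\<close>
    have "inv ((a \<otimes> b) \<otimes> (c \<otimes> a) \<otimes> inv (a \<otimes> b)) \<in> V"
      using v a b by (intro V.m_inv_closed V.inv_op_closed2 m_closed)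
    moreover have "a \<otimes> b \<otimes> inv a \<otimes> inv b
      = inv ((a \<otimes> b) \<otimes> (c \<otimes> a) \<otimes> inv (a \<otimes> b)) \<otimes> (a \<otimes> (b \<otimes> c \<otimes> inv b))"
      using a b c by (simp add: m_assoc inv_mult_group)
    ultimately show ?thesis
      using u unfolding set_mult_def by blast
  qed
  have UV: "V <#> U = carrier G"
    using comm perfect_group_eqI[OF perfect mult_norm_subgroup[OF V.normal_axioms U.subgroup_axioms]]
    by blast
  \<comment> \<open>Conjugation by such a \<open>b\<close> lies in \<open>N\<close> and fixes the
    identity, so by freeness it is trivial and \<open>b\<close> is central.\<close>
  have one: "b = \<one>" if b: "b \<in> V" "b \<in> U" for b
  proof -
    have bc: "b \<in> carrier G" using b by auto
    have "inv b \<in> U" using b by simp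
    then have "two_sided G b \<one> \<otimes>\<^bsub>Sym G\<^esub> two_sided G \<one> (inv b) \<in> N"
      using b by (intro N.m_closed UD VD)
    then have "two_sided G b (inv b) \<in> N"
      using bc by (simp add: two_sided_mult)
    moreover have "two_sided G b (inv b) \<one> = \<one>"
      using bc by (simp add: two_sided_apply)
    ultimately have "two_sided G b (inv b) = \<one>\<^bsub>Sym G\<^esub>"
      using free one_closed by blast
    then have "b \<otimes> x \<otimes> inv b = x" if "x \<in> carrier G" for x
      using that two_sided_apply[of x b "inv b"] by (simp add: BijGroup_one_apply)
    then have "b \<otimes> x = x \<otimes> b" if "x \<in> carrier G" for x
      using that bc by (metis inv_solve_right m_closed)
    then have "b \<in> center G" using bc by (simp add: center_def)
    then show ?thesis using center by simp
  qed
  have decomp: "characteristic_decomposition G U V"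
    using U V UV one commut_normal[OF V.subgroup_axioms U.normal_axioms]
    by (auto simp: characteristic_decomposition_def)
  have two_sided_N: "two_sided G b a \<in> N" if "a \<in> U" "b \<in> V" for a b
  proof -
    have "two_sided G b \<one> \<otimes>\<^bsub>Sym G\<^esub> two_sided G \<one> a \<in> N"
      using that by (intro N.m_closed UD VD)
    then show ?thesis using that by (simp add: two_sided_mult)
  qed
  \<comment> \<open>A regular group is determined by its values at one point: \<open>f\<close> and a
    suitable two-sided translation in \<open>N\<close> agree at the identity.\<close>
  have "f \<in> (\<lambda>(a, b). two_sided G b a) ` (U \<times> V)" if f: "f \<in> N" for f
  proof -
    have fB: "f \<in> Bij (carrier G)" using f NHol Hol_Bij by blast
    then obtain b a where ab: "b \<in> V" "a \<in> U" "f \<one> = b \<otimes> a"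
      using set_mult_carrierE[OF UV, of "f \<one>"] by (metis Bij_apply one_closed)
    let ?k = "two_sided G b a"
    have k: "?k \<in> N" "?k \<in> Bij (carrier G)" using two_sided_N two_sided_Bij ab by auto
    have "?k \<one> = f \<one>" using ab by (simp add: two_sided_apply)
    then have "(inv\<^bsub>Sym G\<^esub> ?k \<otimes>\<^bsub>Sym G\<^esub> f) \<one> = \<one>"
      using fB k BijGroup_inv_apply(2)[OF k(2) one_closed]
      by (simp add: BijGroup_mult_apply BijGroup_inv_closed)
    then have "inv\<^bsub>Sym G\<^esub> ?k \<otimes>\<^bsub>Sym G\<^esub> f = \<one>\<^bsub>Sym G\<^esub>"
      using free[OF one_closed] f k by blast
    then have "f = ?k"
      using fB k(2) by (metis Sym.inv_mult_cancel(2) Sym.r_one carrier_BijGroup)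
    then show ?thesis using ab by auto
  qed
  then have "N = (\<lambda>(a, b). two_sided G b a) ` (U \<times> V)"
    using two_sided_N by auto
  then show ?thesis using decomp by blast
qed

end

section \<open>The conjugating involutions\<close>

text \<open>The value is meaningful once factorizations are unique, which is
  \<open>factor_unique\<close>. The map need not be a homomorphism: it reverses products on
  \<open>V\<close>.\<close>

definition invert_right_factor :: "('a, 'b) monoid_scheme \<Rightarrow> 'a set \<Rightarrow> 'a set \<Rightarrow> 'a \<Rightarrow> 'a" where
  "invert_right_factor G U V =
     (\<lambda>x \<in> carrier G. THE z. \<exists>u \<in> U. \<exists>v \<in> V. x = u \<otimes>\<^bsub>G\<^esub> v \<and> z = u \<otimes>\<^bsub>G\<^esub> inv\<^bsub>G\<^esub> v)"

locale centerless_decomposition = group G for G (structure) +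
  fixes U V
  assumes decomp: "characteristic_decomposition G U V" and center: "center G = {\<one>}"
begin

interpretation Sym: group "Sym G"
  by (rule group_BijGroup)

lemma char_U: "characteristic U G" and char_V: "characteristic V G"
  and disjoint: "U \<inter> V = {\<one>}" and UV: "U <#> V = carrier G"
  using decomp by (simp_all add: characteristic_decomposition_def)

lemma normal_U: "U \<lhd> G" and normal_V: "V \<lhd> G"
  using char_U char_V by (simp_all add: characteristic_imp_normal)

interpretation U: normal U G by (rule normal_U)
interpretation V: normal V G by (rule normal_V)

lemma commute:
  assumes "u \<in> U" "v \<in> V"
  shows "v \<otimes> u = u \<otimes> v"
  using normal_disjoint_commute[OF normal_U normal_V disjoint assms] by simp

text \<open>The element \<open>inv u' \<otimes> u = v' \<otimes> inv v\<close> lies in both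
  factors.\<close>

lemma factor_unique:
  assumes "u \<in> U" "v \<in> V" "u' \<in> U" "v' \<in> V" "u \<otimes> v = u' \<otimes> v'"
  shows "u = u' \<and> v = v'"
proof -
  have carr: "u \<in> carrier G" "v \<in> carrier G" "u' \<in> carrier G" "v' \<in> carrier G"
    using assms by auto
  have "inv u' \<otimes> u = inv u' \<otimes> (u \<otimes> v) \<otimes> inv v"
    using carr by (simp add: m_assoc)
  also have "\<dots> = v' \<otimes> inv v"
    using carr unfolding assms(5) by (simp add: m_assoc)
  finally have eq: "inv u' \<otimes> u = v' \<otimes> inv v" .
  moreover have "inv u' \<otimes> u \<in> U" "v' \<otimes> inv v \<in> V"
    using assms by auto
  ultimately have "inv u' \<otimes> u = \<one>" "v' \<otimes> inv v = \<one>"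
    using disjoint by auto
  then show ?thesis
    using carr by (metis inv_mult_cancel(2) r_one inv_solve_right l_one one_closed)
qed

lemma factorE:
  assumes "x \<in> carrier G"
  obtains u v where "u \<in> U" "v \<in> V" "x = u \<otimes> v"
  using set_mult_carrierE[OF UV assms] by metis

abbreviation \<theta> where "\<theta> \<equiv> invert_right_factor G U V"

lemma \<theta>_apply:
  assumes u: "u \<in> U" and v: "v \<in> V"
  shows "\<theta> (u \<otimes> v) = u \<otimes> inv v"
proof -
  have "(THE z. \<exists>u' \<in> U. \<exists>v' \<in> V. u \<otimes> v = u' \<otimes> v' \<and> z = u' \<otimes> inv v') = u \<otimes> inv v"
  proof (rule the_equality)
    fix z assume "\<exists>u' \<in> U. \<exists>v' \<in> V. u \<otimes> v = u' \<otimes> v' \<and> z = u' \<otimes> inv v'"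
    then obtain u' v' where *: "u' \<in> U" "v' \<in> V" "u \<otimes> v = u' \<otimes> v'" "z = u' \<otimes> inv v'"
      by blast
    then show "z = u \<otimes> inv v"
      using factor_unique[OF u v *(1,2,3)] by simp
  qed (use u v in blast)
  then show ?thesis
    using u v by (simp add: invert_right_factor_def)
qed

lemma \<theta>_closed: "x \<in> carrier G \<Longrightarrow> \<theta> x \<in> carrier G"
  by (erule factorE) (simp add: \<theta>_apply)

lemma \<theta>_\<theta>: "x \<in> carrier G \<Longrightarrow> \<theta> (\<theta> x) = x"
proof (erule factorE)
  fix u v assume "u \<in> U" "v \<in> V" "x = u \<otimes> v"
  then show "\<theta> (\<theta> x) = x"
    using \<theta>_apply[of u "inv v"] by (simp add: \<theta>_apply)
qed

lemma \<theta>_Bij: "\<theta> \<in> Bij (carrier G)"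
proof -
  have "bij_betw \<theta> (carrier G) (carrier G)"
    by (rule bij_betw_byWitness[where f' = \<theta>]) (auto simp: \<theta>_closed \<theta>_\<theta>)
  then show ?thesis by (simp add: Bij_def invert_right_factor_def)
qed

lemma \<theta>_squared: "\<theta> \<otimes>\<^bsub>Sym G\<^esub> \<theta> = \<one>\<^bsub>Sym G\<^esub>"
  using \<theta>_Bij Sym.one_closed
  by (intro Bij_eqI[of _ "carrier G"])
    (simp_all add: BijGroup_mult_closed BijGroup_mult_apply \<theta>_\<theta> BijGroup_one_apply carrier_BijGroup)

lemma \<theta>_inv: "inv\<^bsub>Sym G\<^esub> \<theta> = \<theta>"
  using \<theta>_Bij \<theta>_squared by (intro Sym.inv_equality) (simp_all add: carrier_BijGroup)

text \<open>Right translation acts on the two components separately. On \<open>U\<close> nothing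
  changes, while on \<open>V\<close> inversion turns right multiplication by \<open>b\<close> into
  left multiplication by \<open>inv b\<close>; elements of \<open>U\<close> and \<open>V\<close> may
  be moved past each other.\<close>

lemma \<theta>_conjugate_right_regular:
  assumes a: "a \<in> U" and b: "b \<in> V"
  shows "\<theta> \<otimes>\<^bsub>Sym G\<^esub> right_regular G (a \<otimes> b) \<otimes>\<^bsub>Sym G\<^esub> inv\<^bsub>Sym G\<^esub> \<theta> = two_sided G (inv b) a"
proof (rule BijGroup_conjugate_eq)
  fix x assume "x \<in> carrier G"
  then show "\<theta> (right_regular G (a \<otimes> b) x) = two_sided G (inv b) a (\<theta> x)"
  proof (rule factorE)
    fix u v assume uv: "u \<in> U" "v \<in> V" "x = u \<otimes> v"
    have carr: "a \<in> carrier G" "b \<in> carrier G" "u \<in> carrier G" "v \<in> carrier G"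
      using uv a b by auto
    have "x \<otimes> (a \<otimes> b) = u \<otimes> (v \<otimes> a) \<otimes> b"
      using carr by (simp add: uv m_assoc)
    also have "\<dots> = (u \<otimes> a) \<otimes> (v \<otimes> b)"
      using carr commute[OF a uv(2)] by (simp add: m_assoc)
    finally have "\<theta> (right_regular G (a \<otimes> b) x) = (u \<otimes> a) \<otimes> inv (v \<otimes> b)"
      using \<theta>_apply[OF U.m_closed[OF uv(1) a] V.m_closed[OF uv(2) b]] carr
      by (simp add: right_regular_def uv)
    also have "\<dots> = (u \<otimes> a) \<otimes> inv b \<otimes> inv v"
      using carr by (simp add: inv_mult_group m_assoc)
    also have "\<dots> = inv b \<otimes> (u \<otimes> a) \<otimes> inv v"
      using commute[OF U.m_closed[OF uv(1) a] V.m_inv_closed[OF b]] by simp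
    also have "\<dots> = (inv b \<otimes> u) \<otimes> (a \<otimes> inv v)"
      using carr by (simp add: m_assoc)
    also have "\<dots> = (inv b \<otimes> u) \<otimes> (inv v \<otimes> a)"
      using commute[OF a V.m_inv_closed[OF uv(2)]] by simp
    also have "\<dots> = two_sided G (inv b) a (\<theta> x)"
      using carr \<theta>_apply[OF uv(1,2)] by (simp add: uv two_sided_apply m_assoc)
    finally show ?thesis .
  qed
qed (use a b \<theta>_Bij in \<open>auto simp: right_regular_eq_two_sided two_sided_Bij\<close>)

lemma \<theta>_conjugate_regular:
  "(\<lambda>k. \<theta> \<otimes>\<^bsub>Sym G\<^esub> k \<otimes>\<^bsub>Sym G\<^esub> inv\<^bsub>Sym G\<^esub> \<theta>) ` right_regular G ` carrier G
    = (\<lambda>(a, b). two_sided G b a) ` (U \<times> V)"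
proof (intro equalityI subsetI)
  fix f assume "f \<in> (\<lambda>k. \<theta> \<otimes>\<^bsub>Sym G\<^esub> k \<otimes>\<^bsub>Sym G\<^esub> inv\<^bsub>Sym G\<^esub> \<theta>) ` right_regular G ` carrier G"
  then obtain g where g: "g \<in> carrier G"
    "f = \<theta> \<otimes>\<^bsub>Sym G\<^esub> right_regular G g \<otimes>\<^bsub>Sym G\<^esub> inv\<^bsub>Sym G\<^esub> \<theta>" by auto
  from g(1) obtain a b where "a \<in> U" "b \<in> V" "g = a \<otimes> b" by (rule factorE)
  then have "f = two_sided G (inv b) a" "(a, inv b) \<in> U \<times> V"
    using g(2) \<theta>_conjugate_right_regular by auto
  then show "f \<in> (\<lambda>(a, b). two_sided G b a) ` (U \<times> V)" by force
next
  fix f assume "f \<in> (\<lambda>(a, b). two_sided G b a) ` (U \<times> V)"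
  then obtain a b where ab: "a \<in> U" "b \<in> V" "f = two_sided G b a" by auto
  then have "f = \<theta> \<otimes>\<^bsub>Sym G\<^esub> right_regular G (a \<otimes> inv b) \<otimes>\<^bsub>Sym G\<^esub> inv\<^bsub>Sym G\<^esub> \<theta>"
    using \<theta>_conjugate_right_regular[of a "inv b"] by simp
  moreover have "a \<otimes> inv b \<in> carrier G" using ab by simp
  ultimately show "f \<in> (\<lambda>k. \<theta> \<otimes>\<^bsub>Sym G\<^esub> k \<otimes>\<^bsub>Sym G\<^esub> inv\<^bsub>Sym G\<^esub> \<theta>) ` right_regular G ` carrier G"
    by blast
qed

text \<open>An automorphism preserves both characteristic factors and so commutes with
  \<open>\<theta>\<close>; only the translation part of \<open>f\<close> changes, as in
  \<open>\<theta>_conjugate_right_regular\<close>.\<close>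

lemma \<theta>_conjugate_Hol:
  assumes f: "f \<in> Hol G"
  shows "\<theta> \<otimes>\<^bsub>Sym G\<^esub> f \<otimes>\<^bsub>Sym G\<^esub> inv\<^bsub>Sym G\<^esub> \<theta> \<in> Hol G"
proof -
  obtain \<phi> g where \<phi>: "\<phi> \<in> auto G" and g: "g \<in> carrier G"
    and app: "\<And>x. x \<in> carrier G \<Longrightarrow> f x = \<phi> x \<otimes> g"
    using HolE[OF f] by blast
  from g obtain c d where cd: "c \<in> U" "d \<in> V" "g = c \<otimes> d" by (rule factorE)
  have \<phi>U: "\<phi> u \<in> U" if "u \<in> U" for u
    using char_U \<phi> that unfolding characteristic_def by blast
  have \<phi>V: "\<phi> v \<in> V" if "v \<in> V" for v
    using char_V \<phi> that unfolding characteristic_def by blast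
  have cdG: "c \<in> carrier G" "d \<in> carrier G" using cd by auto
  define h where "h = two_sided G (inv d) c \<otimes>\<^bsub>Sym G\<^esub> \<phi>"
  have h: "h \<in> Hol G"
    unfolding h_def using cdG \<phi> auto_subset_Hol
    by (intro subgroup.m_closed[OF subgroup_Hol] two_sided_Hol) auto
  have "\<theta> \<otimes>\<^bsub>Sym G\<^esub> f \<otimes>\<^bsub>Sym G\<^esub> inv\<^bsub>Sym G\<^esub> \<theta> = h"
  proof (rule BijGroup_conjugate_eq)
    fix x assume "x \<in> carrier G"
    then show "\<theta> (f x) = h (\<theta> x)"
    proof (rule factorE)
      fix u v assume uv: "u \<in> U" "v \<in> V" "x = u \<otimes> v"
      have carr: "u \<in> carrier G" "v \<in> carrier G" using uv by auto
      have "f x = two_sided G \<one> (c \<otimes> d) (\<phi> u \<otimes> \<phi> v)"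
        using carr cd cdG \<phi> by (simp add: app uv two_sided_apply auto_mult auto_closed)
      also have "\<dots> = right_regular G (c \<otimes> d) (\<phi> u \<otimes> \<phi> v)"
        using cdG by (simp add: right_regular_eq_two_sided)
      \<comment> \<open>The argument is written as a value of \<open>\<theta>\<close>, its own
        inverse, so that the conjugation formula for translations applies.\<close>
      finally have "\<theta> (f x) = \<theta> (right_regular G (c \<otimes> d) (\<theta> (\<phi> u \<otimes> inv (\<phi> v))))"
        using \<theta>_apply[OF \<phi>U[OF uv(1)] V.m_inv_closed[OF \<phi>V[OF uv(2)]]] carr \<phi>
        by (simp add: auto_closed)
      also have "\<dots> = (\<theta> \<otimes>\<^bsub>Sym G\<^esub> right_regular G (c \<otimes> d) \<otimes>\<^bsub>Sym G\<^esub> inv\<^bsub>Sym G\<^esub> \<theta>) (\<phi> u \<otimes> inv (\<phi> v))"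
        using \<theta>_Bij cdG carr \<phi>
        by (simp add: \<theta>_inv BijGroup_mult_apply BijGroup_mult_closed right_regular_eq_two_sided
            two_sided_Bij auto_closed \<theta>_closed)
      also have "\<dots> = two_sided G (inv d) c (\<phi> (u \<otimes> inv v))"
        using \<theta>_conjugate_right_regular[OF cd(1,2)] carr \<phi> group_hom.hom_inv[OF auto_group_hom[OF \<phi>]]
        by (simp add: auto_mult)
      also have "\<dots> = h (\<theta> x)"
        using \<theta>_apply[OF uv(1,2)] carr cdG \<phi>
        by (simp add: h_def uv BijGroup_mult_apply two_sided_Bij auto_Bij)
      finally show ?thesis .
    qed
  qed (use \<theta>_Bij f h Hol_Bij in auto)
  then show ?thesis using h by simp
qed

lemma \<theta>_NHol: "\<theta> \<in> NHol G"
proof -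
  have sub: "Hol G \<subseteq> carrier (Sym G)" by (rule subgroup.subset[OF subgroup_Hol])
  have \<theta>: "\<theta> \<in> carrier (Sym G)" using \<theta>_Bij by (simp add: carrier_BijGroup)
  let ?c = "\<lambda>k. \<theta> \<otimes>\<^bsub>Sym G\<^esub> k \<otimes>\<^bsub>Sym G\<^esub> inv\<^bsub>Sym G\<^esub> \<theta>"
  \<comment> \<open>Conjugating the inclusion once more by the involution gives the reverse
    inclusion.\<close>
  have "?c ` Hol G \<subseteq> Hol G" using \<theta>_conjugate_Hol by auto
  moreover from this have "?c ` ?c ` Hol G \<subseteq> ?c ` Hol G" by (rule image_mono)
  then have "Hol G \<subseteq> ?c ` Hol G"
    using Sym.conjugate_image_comp[OF sub \<theta> \<theta>] Sym.conjugate_image_one[OF sub] \<theta>_squared by simp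
  ultimately show ?thesis
    unfolding NHol_def Sym.normalizer_eq[OF sub] using \<theta> by auto
qed

text \<open>Recovers \<open>U\<close> from the regular subgroup as its right translations, which
  makes the count of these subgroups exact. If a right translation equals a two-sided one, the left
  parameter is central, hence trivial.\<close>

lemma regular_determines_factor:
  "U = {a \<in> carrier G. two_sided G \<one> a \<in> (\<lambda>(a, b). two_sided G b a) ` (U \<times> V)}"
proof (intro equalityI subsetI)
  fix a assume "a \<in> U"
  then show "a \<in> {a \<in> carrier G. two_sided G \<one> a \<in> (\<lambda>(a, b). two_sided G b a) ` (U \<times> V)}"
    by (auto intro: image_eqI[of _ _ "(a, \<one>)"])
next
  fix a assume "a \<in> {a \<in> carrier G. two_sided G \<one> a \<in> (\<lambda>(a, b). two_sided G b a) ` (U \<times> V)}"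
  then obtain a' b' where a: "a \<in> carrier G" and ab: "a' \<in> U" "b' \<in> V"
    and eq: "two_sided G \<one> a = two_sided G b' a'" by auto
  have carr: "a' \<in> carrier G" "b' \<in> carrier G" using ab by auto
  have 1: "a = b' \<otimes> a'"
    using fun_cong[OF eq, of \<one>] a carr by (simp add: two_sided_apply)
  have "b' \<otimes> x = x \<otimes> b'" if x: "x \<in> carrier G" for x
  proof -
    have "x \<otimes> b' \<otimes> a' = b' \<otimes> x \<otimes> a'"
      using fun_cong[OF eq, of x] x carr by (simp add: two_sided_apply 1 m_assoc)
    then show ?thesis using x carr by simp
  qed
  then have "b' \<in> center G" using carr by (simp add: center_def)
  then show "a \<in> U" using 1 ab(1) carr center by simp
qed

end

text \<open>Both images correspond to the classes of the same equivalence relation on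
  \<open>S\<close>.\<close>

lemma card_image_eq_if_same_fibers:
  assumes "\<And>x y. x \<in> S \<Longrightarrow> y \<in> S \<Longrightarrow> f x = f y \<longleftrightarrow> g x = g y"
  shows "card (f ` S) = card (g ` S)"
proof -
  have "bij_betw (\<lambda>z. g (inv_into S f z)) (f ` S) (g ` S)"
  proof (rule bij_betw_imageI)
    have inv: "f (inv_into S f (f x)) = f x" "inv_into S f (f x) \<in> S" if "x \<in> S" for x
      using that by (auto intro: f_inv_into_f inv_into_into)
    then have *: "g (inv_into S f (f x)) = g x" if "x \<in> S" for x
      using assms that by blast
    show "inj_on (\<lambda>z. g (inv_into S f z)) (f ` S)"
      using * assms by (auto simp: inj_on_def)
    show "(\<lambda>z. g (inv_into S f z)) ` f ` S = g ` S"
      using * by (auto simp: image_image)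
  qed
  then show ?thesis by (rule bij_betw_same_card)
qed

section \<open>Counting the regular subgroups and determining the quotient
  \<open>T G\<close>\<close>

context group
begin

interpretation Sym: group "Sym G"
  by (rule group_BijGroup)

text \<open>The witness is \<open>\<theta>\<close> for the decomposition belonging to
  \<open>N\<close>.\<close>

lemma JJ_imp_involution_conjugate:
  assumes "perfect_group G" "center G = {\<one>}" "N \<in> JJ G"
  obtains t where "t \<in> NHol G" "t \<otimes>\<^bsub>Sym G\<^esub> t = \<one>\<^bsub>Sym G\<^esub>"
    "N = (\<lambda>k. t \<otimes>\<^bsub>Sym G\<^esub> k \<otimes>\<^bsub>Sym G\<^esub> inv\<^bsub>Sym G\<^esub> t) ` right_regular G ` carrier G"
proof -
  obtain U V where "characteristic_decomposition G U V"
    and N: "N = (\<lambda>(a, b). two_sided G b a) ` (U \<times> V)"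
    using JJ_imp_decomposition[OF assms] by blast
  then interpret centerless_decomposition G U V
    using assms(2)
    by (intro centerless_decomposition.intro centerless_decomposition_axioms.intro is_group)
  show ?thesis
    using that \<theta>_NHol \<theta>_squared \<theta>_conjugate_regular N by metis
qed

lemma JJ_eq_HH:
  assumes "perfect_group G" "center G = {\<one>}"
  shows "JJ G = HH G"
proof (intro equalityI HH_subset_JJ subsetI)
  fix N assume "N \<in> JJ G"
  then obtain t where "t \<in> NHol G"
    "N = (\<lambda>k. t \<otimes>\<^bsub>Sym G\<^esub> k \<otimes>\<^bsub>Sym G\<^esub> inv\<^bsub>Sym G\<^esub> t) ` right_regular G ` carrier G"
    using JJ_imp_involution_conjugate[OF assms] by metis
  then show "N \<in> HH G" using NHol_conjugate_in_HH by simp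
qed

text \<open>Subsets of \<open>{1..n}\<close> parametrize the characteristic decompositions, and each
  decomposition gives one conjugate of the right translations.\<close>

lemma card_HH:
  assumes perfect: "perfect_group G" and center: "center G = {\<one>}" and krs: "KRS_decomposition G n A"
  shows "card (HH G) = 2 ^ n"
proof -
  have idp: "internal_direct_product G {1..n} A"
    and char: "\<And>i. i \<in> {1..n} \<Longrightarrow> characteristic (A i) G"
    and nontriv: "\<And>i. i \<in> {1..n} \<Longrightarrow> A i \<noteq> {\<one>}"
    using krs by (auto simp: KRS_decomposition_def)
  define U where "U S = generate G (\<Union>i \<in> S. A i)" for S
  define N where "N S = (\<lambda>(a, b). two_sided G b a) ` (U S \<times> U ({1..n} - S))" for S
  have dec: "centerless_decomposition G (U S) (U ({1..n} - S))" if "S \<subseteq> {1..n}" for S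
    using internal_direct_product_parts[OF idp that char center] center
    by (unfold_locales) (simp_all add: U_def)
  have "N ` Pow {1..n} = HH G"
  proof (intro equalityI subsetI)
    fix M assume "M \<in> N ` Pow {1..n}"
    then obtain S where S: "S \<subseteq> {1..n}" "M = N S" by auto
    then interpret centerless_decomposition G "U S" "U ({1..n} - S)" by (intro dec)
    show "M \<in> HH G"
      using NHol_conjugate_in_HH[OF \<theta>_NHol] unfolding \<theta>_conjugate_regular S N_def .
  next
    fix M assume "M \<in> HH G"
    then obtain U' V' where UV: "characteristic_decomposition G U' V'"
      "M = (\<lambda>(a, b). two_sided G b a) ` (U' \<times> V')"
      using HH_subset_JJ JJ_imp_decomposition[OF perfect center] by blast
    then obtain S where "S \<subseteq> {1..n}" "U' = U S" "V' = U ({1..n} - S)"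
      using characteristic_decomposition_eq_parts[OF perfect krs] unfolding U_def by blast
    then show "M \<in> N ` Pow {1..n}" using UV by (auto simp: N_def)
  qed
  moreover have "inj_on N (Pow {1..n})"
  proof (rule inj_onI)
    fix S S' assume S: "S \<in> Pow {1..n}" "S' \<in> Pow {1..n}" and eq: "N S = N S'"
    have "U S = U S'"
      using centerless_decomposition.regular_determines_factor[OF dec[of S]]
        centerless_decomposition.regular_determines_factor[OF dec[of S']] S eq
      unfolding N_def by auto
    then show "S = S'"
      using inj_onD[OF internal_direct_product_parts_inj[OF idp nontriv]] S by (auto simp: U_def)
  qed
  ultimately show ?thesis
    by (metis bij_betw_imageI bij_betw_same_card card_Pow finite_atLeastAtMost card_atLeastAtMost diff_Suc_1)
qed

lemma Hol_normal_NHol: "Hol G \<lhd> (Sym G)\<lparr>carrier := NHol G\<rparr>"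
  unfolding NHol_def using subgroup_Hol by (rule Sym.subgroup_in_normalizer)

lemma order_T:
  assumes "perfect_group G" "center G = {\<one>}"
  shows "order (T G) = card (HH G)"
proof -
  let ?R = "right_regular G ` carrier G"
  let ?f = "\<lambda>t. Hol G #>\<^bsub>Sym G\<^esub> t"
  \<comment> \<open>The quotient consists of right cosets, so the conjugation is by the inverse: the
    result is unchanged when \<open>t\<close> is multiplied on the left by an element of
    \<open>Hol G\<close>.\<close>
  let ?g = "\<lambda>t. (\<lambda>k. inv\<^bsub>Sym G\<^esub> t \<otimes>\<^bsub>Sym G\<^esub> k \<otimes>\<^bsub>Sym G\<^esub> inv\<^bsub>Sym G\<^esub> (inv\<^bsub>Sym G\<^esub> t)) ` ?R"
  have NS: "t \<in> carrier (Sym G)" if "t \<in> NHol G" for t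
    using subgroup.mem_carrier[OF subgroup_NHol that] .
  have inv: "inv\<^bsub>Sym G\<^esub> t \<in> NHol G" if "t \<in> NHol G" for t
    using subgroup.m_inv_closed[OF subgroup_NHol that] .
  have "?f s = ?f t \<longleftrightarrow> ?g s = ?g t" if st: "s \<in> NHol G" "t \<in> NHol G" for s t
  proof -
    have "?f s = ?f t \<longleftrightarrow> t \<otimes>\<^bsub>Sym G\<^esub> inv\<^bsub>Sym G\<^esub> s \<in> Hol G"
    proof
      assume "?f s = ?f t"
      then have "t \<in> ?f s"
        using Sym.rcos_self[OF NS[OF st(2)] subgroup_Hol] by simp
      then obtain h where "h \<in> Hol G" "t = h \<otimes>\<^bsub>Sym G\<^esub> s" by (auto simp: r_coset_def)
      then show "t \<otimes>\<^bsub>Sym G\<^esub> inv\<^bsub>Sym G\<^esub> s \<in> Hol G"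
        using NS st subgroup.mem_carrier[OF subgroup_Hol] by (simp add: Sym.m_assoc)
    next
      assume *: "t \<otimes>\<^bsub>Sym G\<^esub> inv\<^bsub>Sym G\<^esub> s \<in> Hol G"
      have "t = (t \<otimes>\<^bsub>Sym G\<^esub> inv\<^bsub>Sym G\<^esub> s) \<otimes>\<^bsub>Sym G\<^esub> s"
        using NS st by (simp add: Sym.m_assoc)
      then have "t \<in> ?f s" using * by (auto simp: r_coset_def)
      then show "?f s = ?f t"
        using Sym.repr_independence[OF _ NS[OF st(1)] subgroup_Hol] by simp
    qed
    also have "\<dots> \<longleftrightarrow> ?g s = ?g t"
      using Sym.conjugate_image_eq_iff[OF subgroup.subset[OF subgroup_right_regular],
          of "inv\<^bsub>Sym G\<^esub> s" "inv\<^bsub>Sym G\<^esub> t"] NS st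
      by (simp add: Hol_def)
    finally show ?thesis .
  qed
  then have "card (?f ` NHol G) = card (?g ` NHol G)"
    by (rule card_image_eq_if_same_fibers)
  moreover have "carrier (T G) = ?f ` NHol G"
    by (simp add: T_def carrier_FactGroup)
  moreover have "?g ` NHol G = HH G"
  proof (intro equalityI subsetI)
    fix N assume "N \<in> HH G"
    then obtain t where t: "t \<in> NHol G" "t \<otimes>\<^bsub>Sym G\<^esub> t = \<one>\<^bsub>Sym G\<^esub>"
      "N = (\<lambda>k. t \<otimes>\<^bsub>Sym G\<^esub> k \<otimes>\<^bsub>Sym G\<^esub> inv\<^bsub>Sym G\<^esub> t) ` ?R"
      using HH_subset_JJ JJ_imp_involution_conjugate[OF assms] by blast
    then have "N = ?g (inv\<^bsub>Sym G\<^esub> t)" using NS by simp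
    then show "N \<in> ?g ` NHol G" using inv t by blast
  qed (use NHol_conjugate_in_HH inv in blast)
  ultimately show ?thesis by (simp add: order_def)
qed

text \<open>Every coset has a representative \<open>t\<close> of square one, namely an involution or
  identity conjugating the right translations to the same subgroup as a given representative
  \<open>s\<close>.\<close>

lemma T_squared:
  assumes "perfect_group G" "center G = {\<one>}" and c: "c \<in> carrier (T G)"
  shows "c \<otimes>\<^bsub>T G\<^esub> c = \<one>\<^bsub>T G\<^esub>"
proof -
  let ?R = "right_regular G ` carrier G"
  interpret NH: group "(Sym G)\<lparr>carrier := NHol G\<rparr>"
    using subgroup_NHol by (rule Sym.subgroup_imp_group)
  interpret H: normal "Hol G" "(Sym G)\<lparr>carrier := NHol G\<rparr>" by (rule Hol_normal_NHol)
  have NS: "t \<in> carrier (Sym G)" if "t \<in> NHol G" for t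
    using subgroup.mem_carrier[OF subgroup_NHol that] .
  obtain s where s: "s \<in> NHol G" "c = Hol G #>\<^bsub>Sym G\<^esub> s"
    using c by (auto simp: T_def carrier_FactGroup)
  obtain t where t: "t \<in> NHol G" "t \<otimes>\<^bsub>Sym G\<^esub> t = \<one>\<^bsub>Sym G\<^esub>"
    and eq: "(\<lambda>k. s \<otimes>\<^bsub>Sym G\<^esub> k \<otimes>\<^bsub>Sym G\<^esub> inv\<^bsub>Sym G\<^esub> s) ` ?R
      = (\<lambda>k. t \<otimes>\<^bsub>Sym G\<^esub> k \<otimes>\<^bsub>Sym G\<^esub> inv\<^bsub>Sym G\<^esub> t) ` ?R"
    using JJ_imp_involution_conjugate[OF assms(1,2)] NHol_conjugate_in_HH[OF s(1)] HH_subset_JJ by blast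
  have st: "inv\<^bsub>Sym G\<^esub> t \<otimes>\<^bsub>Sym G\<^esub> s \<in> Hol G"
    using Sym.conjugate_image_eq_iff[OF subgroup.subset[OF subgroup_right_regular] NS NS] eq s t
    by (auto simp: Hol_def)
  \<comment> \<open>Equality of the conjugates puts \<open>s\<close> in a left coset of
    \<open>Hol G\<close>; conjugating by \<open>t\<close> in \<open>NHol G\<close> puts it in the
    right coset.\<close>
  then have "t \<otimes>\<^bsub>Sym G\<^esub> (inv\<^bsub>Sym G\<^esub> t \<otimes>\<^bsub>Sym G\<^esub> s) \<otimes>\<^bsub>Sym G\<^esub> inv\<^bsub>Sym G\<^esub> t \<in> Hol G"
    using Hol_normal_NHol t(1) unfolding Sym.normal_restrict_iff[OF subgroup_NHol] by blast
  then have h: "s \<otimes>\<^bsub>Sym G\<^esub> inv\<^bsub>Sym G\<^esub> t \<in> Hol G"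
    using NS s t by (simp add: Sym.m_assoc)
  have "s = (s \<otimes>\<^bsub>Sym G\<^esub> inv\<^bsub>Sym G\<^esub> t) \<otimes>\<^bsub>Sym G\<^esub> t"
    using NS s t by (simp add: Sym.m_assoc)
  then have "s \<in> Hol G #>\<^bsub>Sym G\<^esub> t" using h by (auto simp: r_coset_def)
  then have ct: "c = Hol G #>\<^bsub>(Sym G)\<lparr>carrier := NHol G\<rparr>\<^esub> t"
    using Sym.repr_independence[OF _ NS[OF t(1)] subgroup_Hol] s by simp
  have "c \<otimes>\<^bsub>T G\<^esub> c = Hol G #>\<^bsub>(Sym G)\<lparr>carrier := NHol G\<rparr>\<^esub> \<one>\<^bsub>Sym G\<^esub>"
    using H.rcos_sum[of t t] t by (simp add: T_def ct)
  also have "\<dots> = Hol G"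
    using Sym.coset_mult_one[OF subgroup.subset[OF subgroup_Hol]] by simp
  finally show ?thesis by (simp add: T_def)
qed

end

theorem theorem7p7:
  fixes G :: "('a, 'b) monoid_scheme" and A :: "nat \<Rightarrow> 'a set" and n :: nat
  assumes "group G"
    and "finite (carrier G)"
    and "perfect_group G"
    and "center G = {\<one>\<^bsub>G\<^esub>}"
    and "KRS_decomposition G n A"
  shows "(\<forall>N \<in> JJ G. N \<in> HH G \<and> (Sym G)\<lparr>carrier := N\<rparr> \<cong> G) \<and>
         card (HH G) = 2 ^ n \<and>
         elementary_abelian_group 2 (T G) \<and> order (T G) = 2 ^ n"
proof -
  interpret group G by fact
  interpret T: group "T G"
    unfolding T_def using Hol_normal_NHol by (rule normal.factorgroup_is_group)
  have square: "x \<otimes>\<^bsub>T G\<^esub> x = \<one>\<^bsub>T G\<^esub>" if "x \<in> carrier (T G)" for x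
    using T_squared[OF assms(3,4) that] .
  have pow2: "x [^]\<^bsub>T G\<^esub> (2::nat) = x \<otimes>\<^bsub>T G\<^esub> x" if "x \<in> carrier (T G)" for x
    using that by (simp add: numeral_2_eq_2)
  \<comment> \<open>Every element is its own inverse, so inverting a product swaps its factors
    without changing it.\<close>
  have "comm_group (T G)"
  proof (rule T.group_comm_groupI)
    fix x y assume xy: "x \<in> carrier (T G)" "y \<in> carrier (T G)"
    then have "inv\<^bsub>T G\<^esub> x = x" "inv\<^bsub>T G\<^esub> y = y" "inv\<^bsub>T G\<^esub> (x \<otimes>\<^bsub>T G\<^esub> y) = x \<otimes>\<^bsub>T G\<^esub> y"
      using square T.inv_equality T.m_closed by metis+
    then show "x \<otimes>\<^bsub>T G\<^esub> y = y \<otimes>\<^bsub>T G\<^esub> x"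
      using T.inv_mult_group[OF xy] by simp
  qed
  then have "elementary_abelian_group 2 (T G)"
    using square two_is_prime_nat by (simp add: elementary_abelian_group_def pow2)
  moreover have "(Sym G)\<lparr>carrier := N\<rparr> \<cong> G" if "N \<in> HH G" for N
    using that by (simp add: HH_def)
  ultimately show ?thesis
    using JJ_eq_HH[OF assms(3,4)] card_HH[OF assms(3-5)] order_T[OF assms(3,4)] by simp
qed

end
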